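(* Consider the $n$-run scheme with $n\ge 1$ independent non-empty GS trials. Then, with the supremum over all Borel sets $A\subseteq\mathbb{R}^d$, \[ \sup_{A}\bigl|\mathbb{Q}_n(A)-\mathbb{Q}(A)\bigr|\le \frac{c_1}{n},\qquad c_1:=\frac{\operatorname{Var}(M)+\sqrt{\operatorname{Var}(M)\,\mathbb{E}[M^2]}}{m^{2}}, \] and \[ \sup_{A}\mathbb{E}\bigl|\widehat{\mathbb{Q}}_n(A)-\mathbb{Q}(A)\bigr|\le \frac{\tilde c_1(n)}{\sqrt n},\qquad \tilde c_1(n):=\frac{\sqrt{\mathbb{E}[M^2]}+\sqrt{3\,\mathbb{E}[M^4]/n}}{m}, \] where $\tilde c_1(n)$ is bounded uniformly in $n$.
   Context: Standing setup (generalized splitting, GS). Let $f$ be a probability density on $\mathbb{R}^d$, let $S:\mathbb{R}^d\to\mathbb{R}$ be measurable, and let $\gamma\in\mathbb{R}$ be such that $\mathbb{P}(S(\mathbf{X})\ge\gamma)>0$ for $\mathbf{X}\sim f$. Fix an integer splitting factor $s\ge 2$, an integer $\tau\ge 1$ and levels $-\infty=\gamma_0<\gamma_1<\dots<\gamma_\tau=\gamma$. For each $l=0,\dots,\tau$ let $\kappa_l(\mathrm{d}\mathbf{y}\mid\mathbf{x})$ be a Markov transition kernel on $\mathbb{R}^d$ whose stationary distribution has density $q_l(\mathbf{y})=f(\mathbf{y})\mathbb{I}\{S(\mathbf{y})\ge\gamma_l\}/\mathbb{P}(S(\mathbf{X})\ge\gamma_l)$. One GS trial is: generate $\mathbf{Y}\sim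 f$; if $S(\mathbf{Y})<\gamma_1$, return the empty multiset. Otherwise set $\mathcal{X}_1=\{\mathbf{Y}\}$ and for $l=2,\dots,\tau$: set $\mathcal{X}_l=\emptyset$, and for every $\mathbf{Y}\in\mathcal{X}_{l-1}$ put $\mathbf{Y}_0=\mathbf{Y}$ and for $j=1,\dots,s$ sample $\mathbf{Y}_j\sim\kappa_{l-1}(\cdot\mid\mathbf{Y}_{j-1})$ (with fresh independent randomness) and add $\mathbf{Y}_j$ to $\mathcal{X}_l$ if $S(\mathbf{Y}_j)\ge\gamma_l$. The trial returns the multiset $\mathcal{X}_\tau$. A non-empty trial repeats independent GS trials until the returned multiset is non-empty and outputs that multiset $\mathcal{Y}$. Let $M=|\mathcal{Y}|$ (counted with multiplicity), so $1\le M\le s^{\tau-1}$, and for measurable $A$ let $H(A)=|\mathcal{Y}\cap A|$ be the number of elements of $\mathcal{Y}$ (with multiplicity) lying in $A$. Write $m=\mathbb{E}[M]$ and $\operatorname{Var}(M)$ for the variance of $M$. The target distribution is $\mathbb{Q}(A)=\mathbb{P}(\mathbf{X}\in A\mid S(\mathbf{X})\ge\gamma)$, $\mathbf{X}\sim f$. Let $\mathcal{Y}_1,\mathcal{Y}_2,\dots$ be independent non-empty trials with corresponding $M_i$ and $H_i(A)$. $n$-run scheme: $\widehat{\mathbb{Q}}_n(A)=\sum_{i=1}^n H_i(A)\big/\sum_{i=1}^n M_i$ (the empirical distribution of the pooled multiset $\mathcal{Y}_1\cup\dots\cup\mathcal{Y}_n$), and $\mathbb{Q}_n(A)=\mathbb{E}[\widehat{\mathbb{Q}}_n(A)]$.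 *)

theory Defs
  imports "HOL-Probability.Probability"
begin

text \<open>Generalized splitting (GS).  Points live in \<open>real^'d\<close> (i.e. R^d).
  A population (multiset) at level l is encoded as a state \<open>st :: nat \<Rightarrow> 'a \<times> bool\<close>
  on the fixed index set \<open>{..<s^(l-1)}\<close> of tree positions: position c carries a point
  \<open>fst (st c)\<close> and a flag \<open>snd (st c)\<close> saying whether that point is an element of the
  multiset.  Particle c at level l-1 has its s chain states at positions c*s+(j-1),
  j=1..s, at level l.  Chains started from non-members are simulated as well but never
  contribute (their flags stay False), so the multiset of flagged points has exactly the
  law of the GS multiset.\<close>

definition gs_space :: "nat \<Rightarrow> (nat \<Rightarrow> ('a::topological_space) \<times> bool) measure" where
  "gs_space K = PiM {..<K} (\<lambda>_. (borel :: 'a measure) \<Otimes>\<^sub>M count_space (UNIV :: bool set))"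

text \<open>Markov chain of length k started at x: stores Y_1,...,Y_k at indices 0..k-1,
  where Y_0 = x and Y_j ~ K(Y_{j-1}).\<close>
primrec gs_chain :: "('a::topological_space \<Rightarrow> 'a measure) \<Rightarrow> nat \<Rightarrow> 'a \<Rightarrow> (nat \<Rightarrow> 'a) measure" where
  "gs_chain K 0 x = return (PiM {} (\<lambda>_. borel)) (\<lambda>_. undefined)"
| "gs_chain K (Suc k) x =
     bind (gs_chain K k x)
       (\<lambda>ys. distr (K (if k = 0 then x else ys (k - 1))) (PiM {..<Suc k} (\<lambda>_. borel))
              (\<lambda>y. ys(k := y)))"

text \<open>One GS level step from X_{l-1} (state on {..<K}) to X_l (state on {..<K*s}),
  using kernel \<open>kap\<close> = kappa_{l-1} and level \<open>g\<close> = gamma_l: every particle runs an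
  independent chain of length s, and a chain state Y_j is kept iff S(Y_j) >= gamma_l.\<close>
definition gs_step :: "nat \<Rightarrow> ('a::topological_space \<Rightarrow> 'a measure) \<Rightarrow> ('a \<Rightarrow> real) \<Rightarrow> ereal \<Rightarrow> nat
    \<Rightarrow> (nat \<Rightarrow> 'a \<times> bool) \<Rightarrow> (nat \<Rightarrow> 'a \<times> bool) measure" where
  "gs_step s kap S g K st =
     distr (PiM {..<K} (\<lambda>i. gs_chain kap s (fst (st i)))) (gs_space (K * s))
       (\<lambda>Z. \<lambda>c\<in>{..<K * s}. (Z (c div s) (c mod s),
                              snd (st (c div s)) \<and> g \<le> ereal (S (Z (c div s) (c mod s)))))"

text \<open>\<open>gs_levels \<dots> l y\<close> is the law of X_{l+1} given the initial point Y = y.\<close>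
primrec gs_levels :: "nat \<Rightarrow> (nat \<Rightarrow> 'a::topological_space \<Rightarrow> 'a measure) \<Rightarrow> ('a \<Rightarrow> real) \<Rightarrow> (nat \<Rightarrow> ereal)
    \<Rightarrow> nat \<Rightarrow> 'a \<Rightarrow> (nat \<Rightarrow> 'a \<times> bool) measure" where
  "gs_levels s kap S gam 0 y = return (gs_space 1) (\<lambda>i\<in>{..<1}. (y, gam 1 \<le> ereal (S y)))"
| "gs_levels s kap S gam (Suc l) y =
     bind (gs_levels s kap S gam l y) (gs_step s (kap (Suc l)) S (gam (Suc (Suc l))) (s ^ l))"

definition gs_trial :: "('a::euclidean_space \<Rightarrow> real) \<Rightarrow> ('a \<Rightarrow> real) \<Rightarrow> (nat \<Rightarrow> 'a \<Rightarrow> 'a measure)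
    \<Rightarrow> (nat \<Rightarrow> ereal) \<Rightarrow> nat \<Rightarrow> nat \<Rightarrow> (nat \<Rightarrow> 'a \<times> bool) measure" where
  "gs_trial f S kap gam s tau =
     bind (density lborel (\<lambda>x. ennreal (f x))) (gs_levels s kap S gam (tau - 1))"

definition gs_M :: "nat \<Rightarrow> nat \<Rightarrow> (nat \<Rightarrow> 'a \<times> bool) \<Rightarrow> nat" where
  "gs_M s tau st = card {i \<in> {..<s ^ (tau - 1)}. snd (st i)}"

definition gs_H :: "nat \<Rightarrow> nat \<Rightarrow> 'a set \<Rightarrow> (nat \<Rightarrow> 'a \<times> bool) \<Rightarrow> nat" where
  "gs_H s tau A st = card {i \<in> {..<s ^ (tau - 1)}. snd (st i) \<and> fst (st i) \<in> A}"

definition gs_nonempty_trial :: "('a::euclidean_space \<Rightarrow> real) \<Rightarrow> ('a \<Rightarrow> real) \<Rightarrow> (nat \<Rightarrow> 'a \<Rightarrow> 'a measure)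
    \<Rightarrow> (nat \<Rightarrow> ereal) \<Rightarrow> nat \<Rightarrow> nat \<Rightarrow> (nat \<Rightarrow> 'a \<times> bool) measure" where
  "gs_nonempty_trial f S kap gam s tau =
     distr (PiM (UNIV :: nat set) (\<lambda>_. gs_trial f S kap gam s tau)) (gs_space (s ^ (tau - 1)))
       (\<lambda>\<omega>. \<omega> (LEAST i. gs_M s tau (\<omega> i) \<noteq> 0))"

definition gs_runs :: "('a::euclidean_space \<Rightarrow> real) \<Rightarrow> ('a \<Rightarrow> real) \<Rightarrow> (nat \<Rightarrow> 'a \<Rightarrow> 'a measure)
    \<Rightarrow> (nat \<Rightarrow> ereal) \<Rightarrow> nat \<Rightarrow> nat \<Rightarrow> nat \<Rightarrow> (nat \<Rightarrow> nat \<Rightarrow> 'a \<times> bool) measure" where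
  "gs_runs f S kap gam s tau n = PiM {..<n} (\<lambda>_. gs_nonempty_trial f S kap gam s tau)"

definition gs_Qhat :: "nat \<Rightarrow> nat \<Rightarrow> nat \<Rightarrow> 'a set \<Rightarrow> (nat \<Rightarrow> nat \<Rightarrow> 'a \<times> bool) \<Rightarrow> real" where
  "gs_Qhat s tau n A \<omega> =
     (\<Sum>i<n. real (gs_H s tau A (\<omega> i))) / (\<Sum>i<n. real (gs_M s tau (\<omega> i)))"

definition gs_Q :: "('a::euclidean_space \<Rightarrow> real) \<Rightarrow> ('a \<Rightarrow> real) \<Rightarrow> real \<Rightarrow> 'a set \<Rightarrow> real" where
  "gs_Q f S g A =
     measure (density lborel (\<lambda>x. ennreal (f x))) (A \<inter> {x. g \<le> S x})
     / measure (density lborel (\<lambda>x. ennreal (f x))) {x. g \<le> S x}"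

definition gs_q :: "('a::euclidean_space \<Rightarrow> real) \<Rightarrow> ('a \<Rightarrow> real) \<Rightarrow> ereal \<Rightarrow> 'a measure" where
  "gs_q f S g = density lborel (\<lambda>y. ennreal (f y * indicator {x. g \<le> ereal (S x)} y
       / measure (density lborel (\<lambda>x. ennreal (f x))) {x. g \<le> ereal (S x)}))"

end

theory Submission
  imports Defs
begin

text \<open>Stationarity of \<open>\<kappa>\<^sub>l\<close> makes splitting unbiased: by induction over the levels, a trial satisfies
  \<open>E[H(A)] = s^(\<tau>-1) P(X \<in> A, S(X) \<ge> \<gamma>)\<close>.  A non-empty trial has the law of a trial conditioned on being
  non-empty, so \<open>E[H(A)] = Q(A) m\<close> there, i.e. \<open>D = H(A) - Q(A) M\<close> is centered, with \<open>|D| \<le> M\<close>.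
  The error of the estimator is the ratio of the means of \<open>D\<^sub>i\<close> and \<open>M\<^sub>i\<close>; expanding the reciprocal
  of the latter around \<open>m\<close> to second (bias) or first (mean error) order and applying the
  Cauchy-Schwarz inequality gives the two bounds, using \<open>M \<ge> 1\<close> and hence that the ratio is at most 1
  in absolute value.\<close>

section \<open>Kernels and stationarity\<close>

text \<open>Unbiasedness is proved for all nonnegative test functions at once, not only for
  indicators. Going back one level replaces h by the sum, over the s chain times, of its expected
  value after thresholding, so the class of test functions has to be closed under the kernels.
  Counts are linear in the population, hence only the marginal laws of the chain states enter; the
  dependence between points of one trial shows up only in the moments of M, which stay abstract.

  Conditioning on non-emptiness divides E[H(A)] and E[M] by the same unknown probability, so it
  leaves their ratio Q(A) intact. The price is a random denominator and a bias. The bias is of order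
  1/n, not 1/sqrt n, because the term linear in the centered sum of the D has mean 0, and what
  remains involves second moments of sums of n centered independent terms, which grow like n, over
  the squared denominator (n m)^2. Uniformity in A comes from |D| \<le> M: the constants contain
  moments of M only.\<close>

lemma prob_algebra_PiM:
  assumes I: "finite I" and N: "\<And>i. i \<in> I \<Longrightarrow> (\<lambda>x. N x i) \<in> L \<rightarrow>\<^sub>M prob_algebra (M i)"
  shows "(\<lambda>x. PiM I (N x)) \<in> L \<rightarrow>\<^sub>M prob_algebra (PiM I M)"
\<comment> \<open>Boxes are an intersection-stable generator, and on a box the product measure is a
  finite product of measurable functions of x.\<close>
proof (rule measurable_prob_algebra_generated[OF sets_PiM Int_stable_prod_algebra])
  have sp: "prob_space (N x i)" "sets (N x i) = sets (M i)" if "x \<in> space L" "i \<in> I" for x i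
    using measurable_space[OF N[OF that(2)] that(1)] by (auto simp: space_prob_algebra)
  show "prod_algebra I M \<subseteq> Pow (\<Pi>\<^sub>E i\<in>I. space (M i))"
    by (rule prod_algebra_sets_into_space)
  show "prob_space (PiM I (N x))" if "x \<in> space L" for x
    using sp that by (intro prob_space_PiM) auto
  show "sets (PiM I (N x)) = sets (PiM I M)" if "x \<in> space L" for x
    using sp that by (intro sets_PiM_cong) auto
  fix A assume "A \<in> prod_algebra I M"
  then obtain E where A: "A = Pi\<^sub>E I E" and E: "\<And>i. i \<in> I \<Longrightarrow> E i \<in> sets (M i)"
    by (auto elim!: prod_algebraE_all)
  have "emeasure (PiM I (N x)) A = (\<Prod>i\<in>I. emeasure (N x i) (E i))" if "x \<in> space L" for x
  proof -
    \<comment> \<open>\<open>product_prob_space\<close> asks for a probability measure at every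
      index, whereas \<open>N x i\<close> is known to be one only for i in I; a point mass fills the
      other indices.\<close>
    have "PiM I (N x) = PiM I (\<lambda>i. if i \<in> I then N x i else return (count_space UNIV) undefined)"
      by (intro PiM_cong) auto
    moreover interpret product_prob_space "\<lambda>i. if i \<in> I then N x i else return (count_space UNIV) undefined" I
      by (rule product_prob_spaceI) (use sp that in \<open>auto intro: prob_space_return\<close>)
    have "emeasure (PiM I (\<lambda>i. if i \<in> I then N x i else return (count_space UNIV) undefined)) (Pi\<^sub>E I E)
        = (\<Prod>i\<in>I. emeasure (if i \<in> I then N x i else return (count_space UNIV) undefined) (E i))"
      by (rule emeasure_PiM) (use I E sp that in auto)
    ultimately show ?thesis by (simp add: A)
  qed
  moreover have "(\<lambda>x. \<Prod>i\<in>I. emeasure (N x i) (E i)) \<in> borel_measurable L"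
    using E by (intro borel_measurable_prod_ennreal)
       (auto intro: measurable_compose[OF measurable_prob_algebraD[OF N]] measurable_emeasure_subprob_algebra)
  ultimately show "(\<lambda>x. emeasure (PiM I (N x)) A) \<in> borel_measurable L"
    by (subst measurable_cong) auto
qed

lemma prob_kernelD:
  assumes "K \<in> M \<rightarrow>\<^sub>M prob_algebra N" "x \<in> space M"
  shows "prob_space (K x)" "sets (K x) = sets N" "space (K x) = space N"
  using measurable_space[OF assms] by (auto simp: space_prob_algebra dest: sets_eq_imp_space_eq)

lemma nn_integral_kernel_measurable:
  assumes "K \<in> M \<rightarrow>\<^sub>M prob_algebra N" "u \<in> borel_measurable N"
  shows "(\<lambda>x. \<integral>\<^sup>+y. u y \<partial>K x) \<in> borel_measurable M"
  using assms
  by (intro measurable_compose[OF measurable_prob_algebraD nn_integral_measurable_subprob_algebra])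

text \<open>Joint in the starting point and the path: the first transition reads x, every later one
  reads the last stored state, and the bind in \<open>gs_chain\<close> passes both.\<close>

lemma gs_chain_step_kernel:
  assumes K[measurable]: "K \<in> borel \<rightarrow>\<^sub>M prob_algebra borel"
  shows "(\<lambda>(x, ys). distr (K (if k = 0 then x else ys (k - 1))) (PiM {..<Suc k} (\<lambda>_. borel)) (\<lambda>y. ys(k := y)))
      \<in> borel \<Otimes>\<^sub>M PiM {..<k} (\<lambda>_. borel) \<rightarrow>\<^sub>M prob_algebra (PiM {..<Suc k} (\<lambda>_. borel))"
proof -
  have "(\<lambda>z. if k = 0 then fst z else snd z (k - 1)) \<in> borel \<Otimes>\<^sub>M PiM {..<k} (\<lambda>_. borel) \<rightarrow>\<^sub>M borel"
    by (cases k) auto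
  then have 1: "(\<lambda>z. K (if k = 0 then fst z else snd z (k - 1)))
      \<in> borel \<Otimes>\<^sub>M PiM {..<k} (\<lambda>_. borel) \<rightarrow>\<^sub>M prob_algebra borel"
    by (rule measurable_compose[OF _ K])
  have 2: "(\<lambda>z. (snd (fst z))(k := snd z))
      \<in> (borel \<Otimes>\<^sub>M PiM {..<k} (\<lambda>_. borel)) \<Otimes>\<^sub>M borel \<rightarrow>\<^sub>M PiM {..<Suc k} (\<lambda>_. borel)"
    by (rule measurable_fun_upd[where J = "{..<k}"]) auto
  show ?thesis
    using measurable_distr_prob_space2[OF 1, of "\<lambda>z y. (snd z)(k := y)"] 2
    by (simp add: case_prod_beta')
qed

lemma gs_chain_kernel:
  assumes K: "K \<in> borel \<rightarrow>\<^sub>M prob_algebra borel"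
  shows "gs_chain K k \<in> borel \<rightarrow>\<^sub>M prob_algebra (PiM {..<k} (\<lambda>_. borel))"
proof (induction k)
  case 0
  have "return (PiM {} (\<lambda>_. borel)) (\<lambda>_. undefined) \<in> space (prob_algebra (PiM {} (\<lambda>_. borel)))"
    by (auto simp: space_prob_algebra space_PiM intro: prob_space_return)
  then show ?case by simp
next
  case (Suc k)
  show ?case
    using measurable_bind_prob_space2[OF Suc gs_chain_step_kernel[OF K]] by simp
qed

lemma gs_step_kernel:
  assumes K: "kap \<in> borel \<rightarrow>\<^sub>M prob_algebra (borel :: 'a::topological_space measure)"
    and S[measurable]: "S \<in> borel_measurable borel"
  shows "gs_step s kap S g K \<in> gs_space K \<rightarrow>\<^sub>M prob_algebra (gs_space (K * s))"
proof -
  let ?P = "PiM {..<s} (\<lambda>_. borel :: 'a measure)"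
  have 1: "(\<lambda>st. PiM {..<K} (\<lambda>i. gs_chain kap s (fst (st i)))) \<in> gs_space K \<rightarrow>\<^sub>M prob_algebra (PiM {..<K} (\<lambda>_. ?P))"
  proof (rule prob_algebra_PiM)
    fix i assume "i \<in> {..<K}"
    then have "(\<lambda>st. fst (st i)) \<in> gs_space K \<rightarrow>\<^sub>M (borel :: 'a measure)"
      unfolding gs_space_def by measurable
    then show "(\<lambda>st. gs_chain kap s (fst (st i))) \<in> gs_space K \<rightarrow>\<^sub>M prob_algebra ?P"
      by (rule measurable_compose[OF _ gs_chain_kernel[OF K]])
  qed simp
  have 2: "(\<lambda>(st, Z). \<lambda>c\<in>{..<K * s}. (Z (c div s) (c mod s),
        snd (st (c div s)) \<and> g \<le> ereal (S (Z (c div s) (c mod s)))))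
     \<in> (gs_space K :: (nat \<Rightarrow> 'a \<times> bool) measure) \<Otimes>\<^sub>M PiM {..<K} (\<lambda>_. ?P) \<rightarrow>\<^sub>M gs_space (K * s)"
    unfolding gs_space_def case_prod_beta'
  proof (rule measurable_restrict)
    fix c assume "c \<in> {..<K * s}"
    \<comment> \<open>A position below \<open>K * s\<close> exists only if s > 0, so the remainder
      is in range as well.\<close>
    then have c: "c div s < K" "c mod s < s"
      by (auto simp: less_mult_imp_div_less) (metis mod_less_divisor mult_0_right not_gr_zero not_less_zero)
    let ?L = "PiM {..<K} (\<lambda>_. (borel :: 'a measure) \<Otimes>\<^sub>M count_space (UNIV :: bool set)) \<Otimes>\<^sub>M PiM {..<K} (\<lambda>_. ?P)"
    have z[measurable]: "(\<lambda>p. snd p (c div s) (c mod s)) \<in> ?L \<rightarrow>\<^sub>M (borel :: 'a measure)"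
      using c by (intro measurable_compose[OF measurable_compose[OF measurable_snd
            measurable_component_singleton[of "c div s"]] measurable_component_singleton[of "c mod s"]]) auto
    have "(\<lambda>p. fst p (c div s)) \<in> ?L \<rightarrow>\<^sub>M (borel :: 'a measure) \<Otimes>\<^sub>M count_space (UNIV :: bool set)"
      using c by (intro measurable_compose[OF measurable_fst measurable_component_singleton]) auto
    note snd_m = measurable_compose[OF this measurable_snd]
    have "Measurable.pred borel (\<lambda>y. g \<le> ereal (S y))"
      by measurable
    note pred_m = measurable_compose[OF z this]
    show "(\<lambda>p. (snd p (c div s) (c mod s),
        snd (fst p (c div s)) \<and> g \<le> ereal (S (snd p (c div s) (c mod s)))))
      \<in> ?L \<rightarrow>\<^sub>M borel \<Otimes>\<^sub>M count_space UNIV"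
      by (intro measurable_Pair z pred_intros_logic snd_m pred_m)
  qed
  show ?thesis
    unfolding gs_step_def by (rule measurable_distr_prob_space2[OF 1 2])
qed

lemma gs_levels_kernel:
  assumes K: "\<And>i. i \<le> l \<Longrightarrow> kap i \<in> borel \<rightarrow>\<^sub>M prob_algebra (borel :: 'a::topological_space measure)"
    and S[measurable]: "S \<in> borel_measurable borel"
  shows "gs_levels s kap S gam l \<in> borel \<rightarrow>\<^sub>M prob_algebra (gs_space (s ^ l))"
  using K
proof (induction l)
  case 0
  have "(\<lambda>y. \<lambda>i\<in>{..<1::nat}. (y, gam 1 \<le> ereal (S y))) \<in> (borel :: 'a measure) \<rightarrow>\<^sub>M gs_space 1"
    unfolding gs_space_def by measurable
  then show ?case
    using measurable_compose[OF _ measurable_return_prob_space] by fastforce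
next
  case (Suc l)
  have "gs_levels s kap S gam l \<in> borel \<rightarrow>\<^sub>M prob_algebra (gs_space (s ^ l))"
    using Suc by simp
  moreover have "gs_step s (kap (Suc l)) S (gam (Suc (Suc l))) (s ^ l)
      \<in> gs_space (s ^ l) \<rightarrow>\<^sub>M prob_algebra (gs_space (s ^ Suc l))"
    using gs_step_kernel[OF Suc.prems[OF order_refl] S] by (simp add: mult.commute)
  ultimately show ?case
    by (simp add: measurable_bind_prob_space)
qed

section \<open>Expectations along a stationary chain\<close>

lemma nn_integral_gs_chain_Suc:
  assumes K: "K \<in> borel \<rightarrow>\<^sub>M prob_algebra (borel :: 'a::topological_space measure)"
    and u[measurable]: "u \<in> borel_measurable (PiM {..<Suc k} (\<lambda>_. borel))"
  shows "(\<integral>\<^sup>+ys. u ys \<partial>gs_chain K (Suc k) x)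
    = (\<integral>\<^sup>+ys. \<integral>\<^sup>+y. u (ys(k := y)) \<partial>K (if k = 0 then x else ys (k - 1)) \<partial>gs_chain K k x)"
proof -
  let ?P = "\<lambda>k. PiM {..<k} (\<lambda>_. borel :: 'a measure)"
  let ?N = "\<lambda>ys. distr (K (if k = 0 then x else ys (k - 1))) (?P (Suc k)) (\<lambda>y. ys(k := y))"
  have ch: "sets (gs_chain K k x) = sets (?P k)" "space (gs_chain K k x) = space (?P k)"
    using prob_kernelD[OF gs_chain_kernel[OF K]] by auto
  have "?N \<in> ?P k \<rightarrow>\<^sub>M subprob_algebra (?P (Suc k))"
    using measurable_compose[OF measurable_Pair1' gs_chain_step_kernel[OF K, of k], of x]
    by (intro measurable_prob_algebraD) simp
  then have "?N \<in> gs_chain K k x \<rightarrow>\<^sub>M subprob_algebra (?P (Suc k))"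
    using measurable_cong_sets[OF ch(1) refl] by blast
  then have "(\<integral>\<^sup>+ys. u ys \<partial>gs_chain K (Suc k) x) = (\<integral>\<^sup>+ys. \<integral>\<^sup>+z. u z \<partial>?N ys \<partial>gs_chain K k x)"
    by (simp add: nn_integral_bind[OF u])
  also have "\<dots> = (\<integral>\<^sup>+ys. \<integral>\<^sup>+y. u (ys(k := y)) \<partial>K (if k = 0 then x else ys (k - 1)) \<partial>gs_chain K k x)"
  proof (rule nn_integral_cong)
    fix ys assume "ys \<in> space (gs_chain K k x)"
    then have ys: "ys \<in> space (?P k)" by (simp add: ch)
    have "(\<lambda>y. ys(k := y)) \<in> borel \<rightarrow>\<^sub>M ?P (Suc k)"
      by (rule measurable_fun_upd[where J = "{..<k}"]) (use ys in auto)
    then have "(\<lambda>y. ys(k := y)) \<in> K z \<rightarrow>\<^sub>M ?P (Suc k)" for z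
      using prob_kernelD(2)[OF K] measurable_cong_sets by (metis space_borel UNIV_I)
    then show "(\<integral>\<^sup>+z. u z \<partial>?N ys) = (\<integral>\<^sup>+y. u (ys(k := y)) \<partial>K (if k = 0 then x else ys (k - 1)))"
      by (simp add: nn_integral_distr)
  qed
  finally show ?thesis .
qed

text \<open>Integrating out the newest state turns u into the function x \<mapsto> E u(Y) with Y
  drawn from \<open>K x\<close>, evaluated at the state before it. The induction therefore varies u,
  and stationarity of Q removes the extra kernel at the end.\<close>

lemma nn_integral_gs_chain_component:
  assumes K: "K \<in> borel \<rightarrow>\<^sub>M prob_algebra (borel :: 'a::topological_space measure)"
    and Q: "sets Q = sets borel" and stat: "bind Q K = Q"
    and u: "u \<in> borel_measurable borel" and j: "j < k"
  shows "(\<integral>\<^sup>+x. \<integral>\<^sup>+ys. u (ys j) \<partial>gs_chain K k x \<partial>Q) = (\<integral>\<^sup>+x. u x \<partial>Q)"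
  using u j
proof (induction k arbitrary: u j)
  case (Suc k)
  note [measurable] = Suc.prems(1)
  have m: "(\<lambda>ys. u (ys j)) \<in> borel_measurable (PiM {..<Suc k} (\<lambda>_. borel))"
    using Suc.prems by (intro measurable_compose[OF measurable_component_singleton]) auto
  have ku[measurable]: "(\<lambda>x. \<integral>\<^sup>+y. u y \<partial>K x) \<in> borel_measurable borel"
    using nn_integral_kernel_measurable[OF K] Suc.prems by simp
  have stat_u: "(\<integral>\<^sup>+x. \<integral>\<^sup>+y. u y \<partial>K x \<partial>Q) = (\<integral>\<^sup>+x. u x \<partial>Q)"
    using nn_integral_bind[of u borel K Q] measurable_prob_algebraD[OF K] Suc.prems(1)
    unfolding stat by (simp add: measurable_cong_sets[OF Q refl])
  show ?case
  proof (cases "j < k")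
    \<comment> \<open>The newest state is not read, so it integrates to 1.\<close>
    case True
    have "(\<integral>\<^sup>+ys. u (ys j) \<partial>gs_chain K (Suc k) x) = (\<integral>\<^sup>+ys. u (ys j) \<partial>gs_chain K k x)" for x
      unfolding nn_integral_gs_chain_Suc[OF K m]
      using True prob_space.emeasure_space_1[OF prob_kernelD(1)[OF K]]
      by (intro nn_integral_cong) auto
    then show ?thesis
      using Suc.IH[OF Suc.prems(1) True] by simp
  next
    case False
    with Suc.prems have j: "j = k" by simp
    have *: "(\<integral>\<^sup>+ys. u (ys j) \<partial>gs_chain K (Suc k) x)
      = (\<integral>\<^sup>+ys. (\<integral>\<^sup>+y. u y \<partial>K (if k = 0 then x else ys (k - 1))) \<partial>gs_chain K k x)" for x
      using nn_integral_gs_chain_Suc[OF K m, of x] j by (simp del: gs_chain.simps)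
    show ?thesis
    \<comment> \<open>The first transition starts at x itself, where stationarity applies directly;
      for k > 0 the previous state has index \<open>k - 1\<close> and the induction hypothesis is
      used with the averaged function.\<close>
    proof (cases "k = 0")
      case True
      have "prob_space (gs_chain K k x)" for x
        using prob_kernelD(1)[OF gs_chain_kernel[OF K]] by simp
      with True have "(\<integral>\<^sup>+ys. u (ys j) \<partial>gs_chain K (Suc k) x) = (\<integral>\<^sup>+y. u y \<partial>K x)" for x
        unfolding * by (simp add: prob_space.emeasure_space_1 del: gs_chain.simps)
      then show ?thesis using stat_u by simp
    next
      case False
      then show ?thesis
        unfolding * using Suc.IH[OF ku, of "k - 1"] stat_u by simp
    qed
  qed
qed simp

section \<open>Linear statistics of the population and unbiasedness\<close>

text \<open>The values of h are extended nonnegative reals, so that sums and iterated integrals need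
  no integrability conditions while h changes from level to level. The count H(A) is the case of an
  indicator.\<close>

definition gs_sum :: "nat \<Rightarrow> ('a \<Rightarrow> ennreal) \<Rightarrow> (nat \<Rightarrow> 'a \<times> bool) \<Rightarrow> ennreal" where
  "gs_sum K h st = (\<Sum>i<K. if snd (st i) then h (fst (st i)) else 0)"

lemma gs_sum_measurable:
  assumes [measurable]: "h \<in> borel_measurable borel"
  shows "gs_sum K h \<in> borel_measurable (gs_space K)"
  unfolding gs_sum_def gs_space_def by measurable

text \<open>Decodes tree positions: c = i * s + j is chain state j of parent i.\<close>

lemma sum_div_mod:
  fixes F :: "nat \<Rightarrow> nat \<Rightarrow> 'b::comm_monoid_add"
  shows "(\<Sum>c<K * s. F (c div s) (c mod s)) = (\<Sum>i<K. \<Sum>j<s. F i j)"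
proof -
  have "(\<Sum>c<K * s. F (c div s) (c mod s)) = (\<Sum>i<K. \<Sum>c\<in>{i * s..<i * s + s}. F (c div s) (c mod s))"
    by (rule sum.nat_group[symmetric])
  also have "\<dots> = (\<Sum>i<K. \<Sum>j<s. F i j)"
  proof (rule sum.cong)
    fix i
    have "(\<Sum>c\<in>{i * s..<i * s + s}. F (c div s) (c mod s)) = (\<Sum>j=0..<s. F ((j + i * s) div s) ((j + i * s) mod s))"
      using sum.shift_bounds_nat_ivl[of "\<lambda>c. F (c div s) (c mod s)" 0 "i * s" s] by (simp add: add.commute)
    also have "\<dots> = (\<Sum>j<s. F i j)"
      unfolding lessThan_atLeast0 by (rule sum.cong) auto
    finally show "(\<Sum>c\<in>{i * s..<i * s + s}. F (c div s) (c mod s)) = (\<Sum>j<s. F i j)" .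
  qed simp
  finally show ?thesis .
qed

text \<open>By linearity only one-coordinate marginals of the product of chains matter. The
  threshold at g moves into the test function, and the flag of the parent factors out because the
  step does not change it.\<close>

lemma nn_integral_gs_step:
  assumes K: "kap \<in> borel \<rightarrow>\<^sub>M prob_algebra (borel :: 'a::topological_space measure)"
    and S[measurable]: "S \<in> borel_measurable borel"
    and h[measurable]: "h \<in> borel_measurable borel"
    and st: "st \<in> space (gs_space K)"
  shows "(\<integral>\<^sup>+z. gs_sum (K * s) h z \<partial>gs_step s kap S g K st)
    = gs_sum K (\<lambda>x. \<Sum>j<s. \<integral>\<^sup>+ys. h (ys j) * indicator {y. g \<le> ereal (S y)} (ys j) \<partial>gs_chain kap s x) st"
proof -
  let ?P = "PiM {..<s} (\<lambda>_. borel :: 'a measure)"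
  let ?C = "\<lambda>i. gs_chain kap s (fst (st i))"
  let ?h = "\<lambda>y. h y * indicator {y. g \<le> ereal (S y)} y"
  let ?F = "\<lambda>Z. \<lambda>c\<in>{..<K * s}. (Z (c div s) (c mod s),
      snd (st (c div s)) \<and> g \<le> ereal (S (Z (c div s) (c mod s))))"
  have C: "prob_space (?C i)" "sets (?C i) = sets ?P" for i
    using prob_kernelD[OF gs_chain_kernel[OF K]] by auto
  have sets_PiC: "sets (PiM {..<K} ?C) = sets (PiM {..<K} (\<lambda>_. ?P))"
    by (rule sets_PiM_cong) (auto simp: C)
  have hm[measurable]: "?h \<in> borel_measurable borel" by measurable
  have comp[measurable]: "(\<lambda>Z. Z i j) \<in> PiM {..<K} ?C \<rightarrow>\<^sub>M borel" if "i < K" "j < s" for i j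
    unfolding measurable_cong_sets[OF sets_PiC refl]
    using that by (intro measurable_compose[OF measurable_component_singleton[of i] measurable_component_singleton[of j]]) auto
  have F: "?F \<in> PiM {..<K} ?C \<rightarrow>\<^sub>M gs_space (K * s)"
    unfolding gs_space_def
  proof (rule measurable_restrict)
    fix c assume "c \<in> {..<K * s}"
    then have "c div s < K" "c mod s < s"
      by (auto simp: less_mult_imp_div_less) (metis mod_less_divisor mult_0_right not_gr_zero not_less_zero)
    note [measurable] = comp[OF this]
    show "(\<lambda>Z. (Z (c div s) (c mod s), snd (st (c div s)) \<and> g \<le> ereal (S (Z (c div s) (c mod s)))))
        \<in> PiM {..<K} ?C \<rightarrow>\<^sub>M borel \<Otimes>\<^sub>M count_space UNIV"
      by measurable
  qed
  have marg: "(\<integral>\<^sup>+Z. ?h (Z i j) \<partial>PiM {..<K} ?C) = (\<integral>\<^sup>+ys. ?h (ys j) \<partial>?C i)" if "i < K" "j < s" for i j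
  proof -
    have "(\<lambda>ys. ys j) \<in> ?P \<rightarrow>\<^sub>M borel" using that by (intro measurable_component_singleton) auto
    then have m: "(\<lambda>ys. ?h (ys j)) \<in> borel_measurable (?C i)"
      unfolding measurable_cong_sets[OF C(2) refl] by (rule measurable_compose[OF _ hm])
    have "?C i = distr (PiM {..<K} ?C) (?C i) (\<lambda>Z. Z i)"
      by (rule distr_PiM_component[symmetric]) (use C that in auto)
    then have "(\<integral>\<^sup>+ys. ?h (ys j) \<partial>?C i) = (\<integral>\<^sup>+ys. ?h (ys j) \<partial>distr (PiM {..<K} ?C) (?C i) (\<lambda>Z. Z i))"
      by simp
    also have "\<dots> = (\<integral>\<^sup>+Z. ?h (Z i j) \<partial>PiM {..<K} ?C)"
      using that m by (subst nn_integral_distr) auto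
    finally show ?thesis by simp
  qed
  have "(\<integral>\<^sup>+z. gs_sum (K * s) h z \<partial>gs_step s kap S g K st) = (\<integral>\<^sup>+Z. gs_sum (K * s) h (?F Z) \<partial>PiM {..<K} ?C)"
    unfolding gs_step_def using F gs_sum_measurable[OF h] by (subst nn_integral_distr) auto
  also have "\<dots> = (\<integral>\<^sup>+Z. (\<Sum>i<K. \<Sum>j<s. if snd (st i) then ?h (Z i j) else 0) \<partial>PiM {..<K} ?C)"
    unfolding gs_sum_def sum_div_mod[symmetric]
    by (intro nn_integral_cong sum.cong) (auto simp: indicator_def)
  also have "\<dots> = (\<Sum>i<K. \<Sum>j<s. \<integral>\<^sup>+Z. (if snd (st i) then ?h (Z i j) else 0) \<partial>PiM {..<K} ?C)"
  proof -
    have [measurable]: "(\<lambda>Z. if snd (st i) then ?h (Z i j) else 0) \<in> borel_measurable (PiM {..<K} ?C)"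
      if "i < K" "j < s" for i j
      using measurable_compose[OF comp[OF that] hm] by simp
    then show ?thesis
      by (subst nn_integral_sum; (intro sum.cong nn_integral_sum refl borel_measurable_sum)?) auto
  qed
  also have "\<dots> = (\<Sum>i<K. if snd (st i) then \<Sum>j<s. \<integral>\<^sup>+ys. ?h (ys j) \<partial>?C i else 0)"
    by (intro sum.cong refl) (auto simp: marg)
  finally show ?thesis unfolding gs_sum_def .
qed

text \<open>By the induction hypothesis the function produced by the last step is integrated against
  D restricted to level \<open>Suc l\<close>. By \<open>dens\<close> this restriction is a multiple
  of \<open>Q (Suc l)\<close>, under which each of the s chain states keeps the same law. Each chain
  time thus contributes equally, which yields one more factor s, and \<open>dens\<close> read
  backwards removes the constant c again.\<close>

lemma nn_integral_gs_levels:
  fixes D :: "'a::topological_space measure"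
  assumes D: "sets D = sets borel"
    and K: "\<And>i. i \<le> l \<Longrightarrow> kap i \<in> borel \<rightarrow>\<^sub>M prob_algebra borel"
    and S[measurable]: "S \<in> borel_measurable borel"
    and mono: "\<And>i. i \<le> l \<Longrightarrow> gam i \<le> gam (Suc i)"
    and stat: "\<And>i. i \<le> l \<Longrightarrow> sets (Q i) = sets borel" "\<And>i. i \<le> l \<Longrightarrow> bind (Q i) (kap i) = Q i"
    and dens: "\<And>i v. i \<le> l \<Longrightarrow> v \<in> borel_measurable borel \<Longrightarrow>
       (\<integral>\<^sup>+x. v x * indicator {x. gam i \<le> ereal (S x)} x \<partial>D) = c i * (\<integral>\<^sup>+x. v x \<partial>Q i)"
    and h: "h \<in> borel_measurable borel"
  shows "(\<integral>\<^sup>+z. gs_sum (s ^ l) h z \<partial>bind D (gs_levels s kap S gam l))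
    = of_nat (s ^ l) * (\<integral>\<^sup>+x. h x * indicator {x. gam (Suc l) \<le> ereal (S x)} x \<partial>D)"
  using assms(2,4-)
proof (induction l arbitrary: h)
  case 0
  note [measurable] = "0.prems"(6)
  have ker: "gs_levels s kap S gam 0 \<in> D \<rightarrow>\<^sub>M subprob_algebra (gs_space (s ^ 0))"
    unfolding measurable_cong_sets[OF D refl]
    by (rule measurable_prob_algebraD[OF gs_levels_kernel[OF "0.prems"(1) S]])
  have st: "(\<lambda>i\<in>{..<1}. (y, b)) \<in> space (gs_space 1)" for y :: 'a and b
    by (auto simp: gs_space_def space_PiM space_pair_measure)
  have "(\<integral>\<^sup>+z. gs_sum (s ^ 0) h z \<partial>gs_levels s kap S gam 0 y)
      = h y * indicator {x. gam (Suc 0) \<le> ereal (S x)} y" for y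
    using gs_sum_measurable[of h 1] st
    by (simp add: nn_integral_return) (simp add: gs_sum_def indicator_def)
  then show ?case
    using nn_integral_bind[OF gs_sum_measurable[OF "0.prems"(6)] ker] by (simp del: gs_levels.simps)
next
  case (Suc l)
  note [measurable] = Suc.prems(6)
  let ?g = "gam (Suc (Suc l))"
  let ?step = "gs_step s (kap (Suc l)) S ?g (s ^ l)"
  let ?N = "bind D (gs_levels s kap S gam l)"
  let ?u = "\<lambda>y. h y * indicator {y. ?g \<le> ereal (S y)} y"
  let ?h = "\<lambda>x. \<Sum>j<s. \<integral>\<^sup>+ys. ?u (ys j) \<partial>gs_chain (kap (Suc l)) s x"
  have kap: "kap (Suc l) \<in> borel \<rightarrow>\<^sub>M prob_algebra borel" using Suc.prems(1) by simp
  have lev: "gs_levels s kap S gam l \<in> borel \<rightarrow>\<^sub>M prob_algebra (gs_space (s ^ l))"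
    by (rule gs_levels_kernel[OF Suc.prems(1)[OF le_SucI] S])
  have lev': "gs_levels s kap S gam l \<in> D \<rightarrow>\<^sub>M subprob_algebra (gs_space (s ^ l))"
    unfolding measurable_cong_sets[OF D refl] by (rule measurable_prob_algebraD[OF lev])
  have step: "?step \<in> gs_space (s ^ l) \<rightarrow>\<^sub>M subprob_algebra (gs_space (s ^ l * s))"
    by (rule measurable_prob_algebraD[OF gs_step_kernel[OF kap S]])
  have sets_N: "sets ?N = sets (gs_space (s ^ l))"
    using prob_kernelD(2)[OF lev] sets_eq_imp_space_eq[OF D] by (intro sets_bind) auto
  have u[measurable]: "?u \<in> borel_measurable borel" by measurable
  have comp: "(\<lambda>x. \<integral>\<^sup>+ys. ?u (ys j) \<partial>gs_chain (kap (Suc l)) s x) \<in> borel_measurable borel" if "j < s" for j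
    using that by (intro nn_integral_kernel_measurable[OF gs_chain_kernel[OF kap]]
        measurable_compose[OF _ u] measurable_component_singleton) auto
  then have h': "?h \<in> borel_measurable borel" by (intro borel_measurable_sum) auto
  have "(\<integral>\<^sup>+z. gs_sum (s ^ Suc l) h z \<partial>bind D (gs_levels s kap S gam (Suc l)))
      = (\<integral>\<^sup>+z. gs_sum (s ^ l * s) h z \<partial>bind ?N ?step)"
  proof -
    \<comment> \<open>Reassociating the binds averages over the initial point first, so the last
      step acts on \<open>?N\<close>, the law to which the induction hypothesis refers.\<close>
    have "gs_levels s kap S gam (Suc l) = (\<lambda>y. bind (gs_levels s kap S gam l y) ?step)"
      by (rule ext) simp
    then show ?thesis by (simp add: bind_assoc[OF lev' step] mult.commute del: gs_levels.simps)
  qed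
  also have "\<dots> = (\<integral>\<^sup>+st. \<integral>\<^sup>+z. gs_sum (s ^ l * s) h z \<partial>?step st \<partial>?N)"
    using step by (intro nn_integral_bind[OF gs_sum_measurable]) (simp_all add: measurable_cong_sets[OF sets_N refl])
  also have "\<dots> = (\<integral>\<^sup>+st. gs_sum (s ^ l) ?h st \<partial>?N)"
    using sets_eq_imp_space_eq[OF sets_N]
    by (intro nn_integral_cong nn_integral_gs_step[OF kap S]) auto
  also have "\<dots> = of_nat (s ^ l) * (\<integral>\<^sup>+x. ?h x * indicator {x. gam (Suc l) \<le> ereal (S x)} x \<partial>D)"
    by (rule Suc.IH[OF _ _ _ _ _ h'], (rule Suc.prems le_SucI | assumption)+)
  also have "(\<integral>\<^sup>+x. ?h x * indicator {x. gam (Suc l) \<le> ereal (S x)} x \<partial>D) = c (Suc l) * (\<integral>\<^sup>+x. ?h x \<partial>Q (Suc l))"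
    using Suc.prems(5)[OF order_refl h'] .
  also have "(\<integral>\<^sup>+x. ?h x \<partial>Q (Suc l)) = (\<Sum>j<s. \<integral>\<^sup>+x. \<integral>\<^sup>+ys. ?u (ys j) \<partial>gs_chain (kap (Suc l)) s x \<partial>Q (Suc l))"
    using comp by (intro nn_integral_sum) (auto simp: measurable_cong_sets[OF Suc.prems(3)[OF order_refl] refl])
  also have "\<dots> = (\<Sum>j<s. \<integral>\<^sup>+x. ?u x \<partial>Q (Suc l))"
    by (intro sum.cong refl nn_integral_gs_chain_component[OF kap _ _ u] Suc.prems(3,4) order_refl) simp
  also have "c (Suc l) * \<dots> = of_nat s * (c (Suc l) * (\<integral>\<^sup>+x. ?u x \<partial>Q (Suc l)))"
    by (simp add: mult_ac)
  also have "c (Suc l) * (\<integral>\<^sup>+x. ?u x \<partial>Q (Suc l)) = (\<integral>\<^sup>+x. ?u x * indicator {x. gam (Suc l) \<le> ereal (S x)} x \<partial>D)"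
    using Suc.prems(5)[OF order_refl u] by simp
  \<comment> \<open>A point above the next level is above the current one, so the lower indicator is
    absorbed.\<close>
  also have "\<dots> = (\<integral>\<^sup>+x. ?u x \<partial>D)"
    using Suc.prems(2)[OF order_refl] by (intro nn_integral_cong) (auto simp: indicator_def)
  finally show ?case by (simp add: mult_ac)
qed

section \<open>First success in a sequence of independent trials\<close>

lemma measurable_first_success:
  assumes [measurable]: "Measurable.pred T P"
  shows "(\<lambda>\<omega>. \<omega> (LEAST i. P (\<omega> i))) \<in> PiM (UNIV :: nat set) (\<lambda>_. T) \<rightarrow>\<^sub>M T"
proof (rule measurable_compose_countable[where f = "\<lambda>i \<omega>. \<omega> i"])
  have "(\<lambda>\<omega>. P (\<omega> i)) \<in> PiM (UNIV :: nat set) (\<lambda>_. T) \<rightarrow>\<^sub>M count_space UNIV" for i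
    by measurable
  then show "(\<lambda>\<omega>. LEAST i. P (\<omega> i)) \<in> PiM (UNIV :: nat set) (\<lambda>_. T) \<rightarrow>\<^sub>M count_space UNIV"
    by (rule measurable_Least)
qed simp

lemma ennreal_add_left_cancelD: "a + b = a + c \<Longrightarrow> a \<noteq> \<infinity> \<Longrightarrow> b = (c :: ennreal)"
  by (simp add: ennreal_add_left_cancel)

text \<open>Conditioning on the first trial gives the renewal equation \<open>I = \<integral>h + (1 - p) I\<close>.  The junk
  value of \<open>LEAST\<close> on a sequence of failures is harmless because \<open>h\<close> vanishes on failures.\<close>

lemma nn_integral_first_success:
  fixes h :: "'a \<Rightarrow> ennreal"
  assumes T: "prob_space T" and pred[measurable]: "Measurable.pred T P" and h[measurable]: "h \<in> borel_measurable T"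
    and h0: "\<And>x. x \<in> space T \<Longrightarrow> \<not> P x \<Longrightarrow> h x = 0"
    and B: "\<And>x. x \<in> space T \<Longrightarrow> h x \<le> ennreal B"
  shows "emeasure T {x \<in> space T. P x} * (\<integral>\<^sup>+\<omega>. h (\<omega> (LEAST i. P (\<omega> i))) \<partial>PiM (UNIV :: nat set) (\<lambda>_. T))
    = (\<integral>\<^sup>+x. h x \<partial>T)"
proof -
  interpret T: prob_space T by (rule T)
  interpret sequence_space T
    unfolding sequence_space_def by (rule product_prob_spaceI) (rule T)
  let ?X = "\<lambda>\<omega>. \<omega> (LEAST i. P (\<omega> i))"
  let ?S = "PiM (UNIV :: nat set) (\<lambda>_. T)"
  let ?I = "\<integral>\<^sup>+\<omega>. h (?X \<omega>) \<partial>?S"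
  have X[measurable]: "?X \<in> ?S \<rightarrow>\<^sub>M T" by (rule measurable_first_success[OF pred])
  have rec: "h (?X (case_nat x \<omega>)) = (if P x then h x else h (?X \<omega>))"
    if x: "x \<in> space T" and w: "\<omega> \<in> space ?S" for x \<omega>
  proof -
    have w': "\<omega> i \<in> space T" for i using w by (auto simp: space_PiM)
    show ?thesis
    proof (cases "P x")
      case True
      then have "(LEAST i. P (case_nat x \<omega> i)) = 0" by (intro Least_equality) auto
      with True show ?thesis by simp
    next
      case False
      show ?thesis
      proof (cases "\<exists>i. P (\<omega> i)")
        case True
        then obtain i where "P (\<omega> i)" ..
        then have "(LEAST i. P (case_nat x \<omega> i)) = Suc (LEAST i. P (\<omega> i))"
          using Least_Suc[of "\<lambda>i. P (case_nat x \<omega> i)" "Suc i"] False by simp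
        with False show ?thesis by simp
      next
        case none: False
        have "\<not> P (case_nat x \<omega> k)" "case_nat x \<omega> k \<in> space T" for k
          using none False w' x by (auto split: nat.split)
        then have "h (?X (case_nat x \<omega>)) = 0" by (rule h0[rotated])
        moreover have "h (?X \<omega>) = 0" using none w' by (intro h0) auto
        ultimately show ?thesis using False by simp
      qed
    qed
  qed
  \<comment> \<open>The bound B is what makes \<open>?I\<close> finite, hence cancellable from an
    equation in the extended reals.\<close>
  have "?I \<le> (\<integral>\<^sup>+\<omega>. ennreal B \<partial>?S)"
    using measurable_space[OF X] by (intro nn_integral_mono B) auto
  also have "\<dots> = ennreal B" by (simp add: P.emeasure_space_1)
  finally have fin: "?I < \<top>" using ennreal_less_top le_less_trans by blast
  let ?p = "emeasure T {x \<in> space T. P x}" and ?q = "emeasure T {x \<in> space T. \<not> P x}"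
  have pq: "?p + ?q = 1"
  proof -
    have "?p + ?q = emeasure T ({x \<in> space T. P x} \<union> {x \<in> space T. \<not> P x})"
      by (rule plus_emeasure) auto
    also have "{x \<in> space T. P x} \<union> {x \<in> space T. \<not> P x} = space T" by auto
    finally show ?thesis by (simp add: T.emeasure_space_1)
  qed
  \<comment> \<open>The sequence law is invariant under prepending an independent trial, so after a
    failed head the search on the tail has the same expectation \<open>?I\<close>.\<close>
  have "?I = (\<integral>\<^sup>+\<omega>. h (?X \<omega>) \<partial>distr (T \<Otimes>\<^sub>M ?S) ?S (\<lambda>(s, \<omega>). case_nat s \<omega>))"
    by (simp only: PiM_iter)
  also have "\<dots> = (\<integral>\<^sup>+z. h (?X (case_nat (fst z) (snd z))) \<partial>(T \<Otimes>\<^sub>M ?S))"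
    by (subst nn_integral_distr) (auto simp: case_prod_beta')
  also have "\<dots> = (\<integral>\<^sup>+z. (if P (fst z) then h (fst z) else h (?X (snd z))) \<partial>(T \<Otimes>\<^sub>M ?S))"
    by (intro nn_integral_cong) (auto simp: space_pair_measure rec)
  also have "\<dots> = (\<integral>\<^sup>+x. \<integral>\<^sup>+\<omega>. (if P x then h x else h (?X \<omega>)) \<partial>?S \<partial>T)"
    by (subst P.nn_integral_fst[symmetric]) (simp_all cong: if_cong)
  also have "\<dots> = (\<integral>\<^sup>+x. h x + ?I * indicator {x \<in> space T. \<not> P x} x \<partial>T)"
  proof (rule nn_integral_cong)
    fix x assume "x \<in> space T"
    then show "(\<integral>\<^sup>+\<omega>. (if P x then h x else h (?X \<omega>)) \<partial>?S) = h x + ?I * indicator {x \<in> space T. \<not> P x} x"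
      by (cases "P x") (auto simp: P.emeasure_space_1 h0)
  qed
  also have "\<dots> = (\<integral>\<^sup>+x. h x \<partial>T) + ?I * ?q"
    by (subst nn_integral_add) (auto simp: nn_integral_cmult_indicator)
  \<comment> \<open>Writing 1 as \<open>?p + ?q\<close> produces the term \<open>?I * ?q\<close> on
    both sides, so it is cancelled and no subtraction occurs.\<close>
  finally have "?I * (?p + ?q) = (\<integral>\<^sup>+x. h x \<partial>T) + ?I * ?q"
    by (simp add: pq)
  then have eq: "?I * ?q + ?p * ?I = ?I * ?q + (\<integral>\<^sup>+x. h x \<partial>T)"
    by (simp add: algebra_simps)
  have "?I * ?q \<noteq> \<infinity>"
    using ennreal_mult_less_top[of ?I ?q] fin less_top[THEN iffD1, OF T.emeasure_finite[of "{x \<in> space T. \<not> P x}"]]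
    by simp
  then show ?thesis
    by (rule ennreal_add_left_cancelD[OF eq])
qed

section \<open>Ratio estimators\<close>

text \<open>Boundedness on the whole space is closed under all the algebraic operations used below
  and implies integrability on finite measures, so every integrability obligation reduces to
  it.\<close>

definition bounded_rv :: "'a measure \<Rightarrow> ('a \<Rightarrow> real) \<Rightarrow> bool" where
  "bounded_rv N X \<longleftrightarrow> X \<in> borel_measurable N \<and> (\<exists>C. \<forall>x\<in>space N. \<bar>X x\<bar> \<le> C)"

lemma bounded_rvI:
  "X \<in> borel_measurable N \<Longrightarrow> (\<And>x. x \<in> space N \<Longrightarrow> \<bar>X x\<bar> \<le> C) \<Longrightarrow> bounded_rv N X"
  unfolding bounded_rv_def by blast

lemma bounded_rv_measurable: "bounded_rv N X \<Longrightarrow> X \<in> borel_measurable N"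
  unfolding bounded_rv_def by blast

lemma bounded_rv_const: "bounded_rv N (\<lambda>_. c)"
  by (rule bounded_rvI[where C = "\<bar>c\<bar>"]) auto

lemma bounded_rv_add:
  assumes "bounded_rv N X" "bounded_rv N Y"
  shows "bounded_rv N (\<lambda>x. X x + Y x)"
proof -
  obtain C D where CD: "\<And>x. x \<in> space N \<Longrightarrow> \<bar>X x\<bar> \<le> C" "\<And>x. x \<in> space N \<Longrightarrow> \<bar>Y x\<bar> \<le> D"
    using assms unfolding bounded_rv_def by blast
  have "\<bar>X x + Y x\<bar> \<le> C + D" if "x \<in> space N" for x
    using CD[OF that] by linarith
  then show ?thesis
    using assms[THEN bounded_rv_measurable] by (intro bounded_rvI) auto
qed

lemma bounded_rv_mult:
  assumes "bounded_rv N X" "bounded_rv N Y"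
  shows "bounded_rv N (\<lambda>x. X x * Y x)"
proof -
  obtain C D where CD: "\<And>x. x \<in> space N \<Longrightarrow> \<bar>X x\<bar> \<le> C" "\<And>x. x \<in> space N \<Longrightarrow> \<bar>Y x\<bar> \<le> D"
    using assms unfolding bounded_rv_def by blast
  have "\<bar>X x * Y x\<bar> \<le> C * D" if "x \<in> space N" for x
    unfolding abs_mult using CD[OF that] by (intro mult_mono) auto
  then show ?thesis
    using assms[THEN bounded_rv_measurable] by (intro bounded_rvI) auto
qed

lemma bounded_rv_diff:
  assumes "bounded_rv N X" "bounded_rv N Y"
  shows "bounded_rv N (\<lambda>x. X x - Y x)"
  using bounded_rv_add[OF assms(1) bounded_rv_mult[OF bounded_rv_const[of N "-1"] assms(2)]] by simp

lemma bounded_rv_power: "bounded_rv N X \<Longrightarrow> bounded_rv N (\<lambda>x. X x ^ k)"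
  by (induction k) (auto intro: bounded_rv_const bounded_rv_mult)

lemma bounded_rv_divide_const: "bounded_rv N X \<Longrightarrow> bounded_rv N (\<lambda>x. X x / c)"
  using bounded_rv_mult[OF _ bounded_rv_const[of N "1 / c"]] by simp

lemma bounded_rv_abs: "bounded_rv N X \<Longrightarrow> bounded_rv N (\<lambda>x. \<bar>X x\<bar>)"
  unfolding bounded_rv_def by auto

lemma bounded_rv_sum: "(\<And>i. i \<in> I \<Longrightarrow> bounded_rv N (X i)) \<Longrightarrow> bounded_rv N (\<lambda>x. \<Sum>i\<in>I. X i x)"
  by (induction I rule: infinite_finite_induct) (auto intro: bounded_rv_const bounded_rv_add)

lemmas bounded_rv_intros = bounded_rv_const bounded_rv_add bounded_rv_mult bounded_rv_diff
  bounded_rv_power bounded_rv_divide_const bounded_rv_abs bounded_rv_sum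

lemma bounded_rv_component:
  assumes "bounded_rv N X" "i \<in> I"
  shows "bounded_rv (PiM I (\<lambda>_. N)) (\<lambda>\<omega>. X (\<omega> i))"
proof -
  obtain C where "\<And>x. x \<in> space N \<Longrightarrow> \<bar>X x\<bar> \<le> C"
    using assms unfolding bounded_rv_def by blast
  then show ?thesis
    using assms(2) measurable_compose[OF measurable_component_singleton[OF assms(2)] bounded_rv_measurable[OF assms(1)]]
    by (intro bounded_rvI[where C = C]) (auto simp: space_PiM PiE_iff)
qed

lemma (in finite_measure) integrable_bounded_rv: "bounded_rv M X \<Longrightarrow> integrable M X"
  unfolding bounded_rv_def by (auto intro!: integrable_const_bound AE_I2)

text \<open>The integral of (s X + t Y)^2 is a nonnegative quadratic form in (s, t); the inequality
  follows from its value at a single well-chosen point.\<close>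

lemma (in finite_measure) Cauchy_Schwarz_bounded_rv:
  assumes X: "bounded_rv M X" and Y: "bounded_rv M Y"
  shows "\<bar>\<integral>x. X x * Y x \<partial>M\<bar> \<le> sqrt ((\<integral>x. (X x)\<^sup>2 \<partial>M) * (\<integral>x. (Y x)\<^sup>2 \<partial>M))"
proof -
  let ?a = "\<integral>x. (X x)\<^sup>2 \<partial>M" and ?b = "\<integral>x. X x * Y x \<partial>M" and ?c = "\<integral>x. (Y x)\<^sup>2 \<partial>M"
  note int = integrable_bounded_rv[OF bounded_rv_power[OF X, of 2]]
    integrable_bounded_rv[OF bounded_rv_power[OF Y, of 2]] integrable_bounded_rv[OF bounded_rv_mult[OF X Y]]
  have quad: "0 \<le> s\<^sup>2 * ?a + 2 * s * t * ?b + t\<^sup>2 * ?c" for s t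
  proof -
    have "0 \<le> (\<integral>x. (s * X x + t * Y x)\<^sup>2 \<partial>M)" by simp
    also have "\<dots> = (\<integral>x. s\<^sup>2 * (X x)\<^sup>2 + 2 * s * t * (X x * Y x) + t\<^sup>2 * (Y x)\<^sup>2 \<partial>M)"
      by (intro Bochner_Integration.integral_cong) (auto simp: power2_eq_square algebra_simps)
    also have "\<dots> = s\<^sup>2 * ?a + 2 * s * t * ?b + t\<^sup>2 * ?c"
      using int by simp
    finally show ?thesis .
  qed
  have "?b\<^sup>2 \<le> ?a * ?c"
  proof (cases "?c = 0")
    case True
    have "?b = 0"
    proof (rule ccontr)
      assume "?b \<noteq> 0"
      \<comment> \<open>With c = 0 and s = 1 the form is a + 2 t b, and this t makes it equal to
        -1.\<close>
      then show False using quad[of 1 "- (?a + 1) / (2 * ?b)"] True by (simp add: field_simps)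
    qed
    with True show ?thesis by simp
  next
    case False
    then have c: "?c > 0" by (simp add: order_less_le)
    \<comment> \<open>At s = c and t = -b the form factors as c (a c - b^2).\<close>
    have "0 \<le> ?c * (?a * ?c - ?b\<^sup>2)"
      using quad[of ?c "- ?b"] by (simp add: power2_eq_square algebra_simps)
    with c show ?thesis by (simp add: zero_le_mult_iff)
  qed
  then show ?thesis by (metis real_sqrt_abs real_sqrt_le_mono)
qed

section \<open>Second moments of sums over independent runs\<close>

lemma integral_PiM_component:
  fixes X :: "'a \<Rightarrow> real"
  assumes N: "prob_space N" and X: "X \<in> borel_measurable N" and i: "i \<in> I"
  shows "(\<integral>\<omega>. X (\<omega> i) \<partial>PiM I (\<lambda>_. N)) = (\<integral>x. X x \<partial>N)"
proof -
  have "(\<integral>x. X x \<partial>N) = (\<integral>x. X x \<partial>distr (PiM I (\<lambda>_. N)) N (\<lambda>\<omega>. \<omega> i))"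
    using distr_PiM_component[of I "\<lambda>_. N" i] N i by simp
  also have "\<dots> = (\<integral>\<omega>. X (\<omega> i) \<partial>PiM I (\<lambda>_. N))"
    by (rule integral_distr) (use X i in auto)
  finally show ?thesis by simp
qed

lemma integral_PiM_component_mult:
  fixes X Y :: "'a \<Rightarrow> real"
  assumes N: "prob_space N" and X: "bounded_rv N X" and Y: "bounded_rv N Y"
    and I: "finite I" "i \<in> I" "j \<in> I" "i \<noteq> j"
  shows "(\<integral>\<omega>. X (\<omega> i) * Y (\<omega> j) \<partial>PiM I (\<lambda>_. N)) = (\<integral>x. X x \<partial>N) * (\<integral>x. Y x \<partial>N)"
proof -
  interpret N: prob_space N by (rule N)
  interpret product_prob_space "\<lambda>_. N" I by (rule product_prob_spaceI) (rule N)
  \<comment> \<open>Coordinates other than i and j get the factor 1, which puts the integrand into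
    the shape of a product over all of I.\<close>
  let ?f = "\<lambda>k. if k = i then X else if k = j then Y else (\<lambda>_. 1)"
  have split: "(\<Prod>k\<in>I. F k) = F i * F j" if "\<And>k. k \<noteq> i \<Longrightarrow> k \<noteq> j \<Longrightarrow> F k = 1" for F :: "_ \<Rightarrow> real"
  proof -
    have "(\<Prod>k\<in>I. F k) = (\<Prod>k\<in>{i, j}. F k)"
      using I that by (intro prod.mono_neutral_right) auto
    then show ?thesis using I by simp
  qed
  have "(\<integral>\<omega>. X (\<omega> i) * Y (\<omega> j) \<partial>PiM I (\<lambda>_. N)) = (\<integral>\<omega>. (\<Prod>k\<in>I. ?f k (\<omega> k)) \<partial>PiM I (\<lambda>_. N))"
    using I by (subst split) auto
  also have "\<dots> = (\<Prod>k\<in>I. \<integral>x. ?f k x \<partial>N)"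
    using X Y I by (intro product_integral_prod) (auto intro: N.integrable_bounded_rv bounded_rv_const)
  also have "\<dots> = (\<integral>x. X x \<partial>N) * (\<integral>x. Y x \<partial>N)"
    using I by (subst split) (auto simp: N.prob_space)
  finally show ?thesis .
qed

text \<open>An off-diagonal term factors by independence and vanishes as soon as one factor is
  centered, so only the card I diagonal terms survive. Centering X alone is enough, and the same
  identity serves the pairs (D, M - m), (D, D) and (M - m, M - m).\<close>

lemma integral_PiM_sum_mult:
  fixes X Y :: "'a \<Rightarrow> real"
  assumes N: "prob_space N" and X: "bounded_rv N X" and Y: "bounded_rv N Y"
    and X0: "(\<integral>x. X x \<partial>N) = 0" and I: "finite I"
  shows "(\<integral>\<omega>. (\<Sum>i\<in>I. X (\<omega> i)) * (\<Sum>i\<in>I. Y (\<omega> i)) \<partial>PiM I (\<lambda>_. N)) = real (card I) * (\<integral>x. X x * Y x \<partial>N)"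
proof -
  interpret P: prob_space "PiM I (\<lambda>_. N)" by (rule prob_space_PiM) (rule N)
  have bd: "bounded_rv (PiM I (\<lambda>_. N)) (\<lambda>\<omega>. X (\<omega> i) * Y (\<omega> j))" if "i \<in> I" "j \<in> I" for i j
    using that X Y by (intro bounded_rv_intros bounded_rv_component)
  have "(\<integral>\<omega>. (\<Sum>i\<in>I. X (\<omega> i)) * (\<Sum>i\<in>I. Y (\<omega> i)) \<partial>PiM I (\<lambda>_. N))
      = (\<integral>\<omega>. (\<Sum>i\<in>I. \<Sum>j\<in>I. X (\<omega> i) * Y (\<omega> j)) \<partial>PiM I (\<lambda>_. N))"
    by (simp add: sum_product)
  also have "\<dots> = (\<Sum>i\<in>I. \<Sum>j\<in>I. \<integral>\<omega>. X (\<omega> i) * Y (\<omega> j) \<partial>PiM I (\<lambda>_. N))"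
    using bd by (simp add: Bochner_Integration.integral_sum P.integrable_bounded_rv bounded_rv_sum)
  also have "\<dots> = (\<Sum>i\<in>I. \<Sum>j\<in>I. if j = i then (\<integral>x. X x * Y x \<partial>N) else 0)"
  proof (intro sum.cong refl)
    fix i j assume "i \<in> I" "j \<in> I"
    then show "(\<integral>\<omega>. X (\<omega> i) * Y (\<omega> j) \<partial>PiM I (\<lambda>_. N)) = (if j = i then (\<integral>x. X x * Y x \<partial>N) else 0)"
      using integral_PiM_component_mult[OF N X Y I] X0
        integral_PiM_component[OF N, of "\<lambda>x. X x * Y x"] bounded_rv_measurable[OF bounded_rv_mult[OF X Y]]
      by auto
  qed
  also have "\<dots> = real (card I) * (\<integral>x. X x * Y x \<partial>N)"
    using I by simp
  finally show ?thesis .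
qed

text \<open>Since \<open>1 / (a + v)\<close> equals \<open>1 / a - v / a\<^sup>2 + v\<^sup>2 / (a\<^sup>2 (a + v))\<close> and \<open>1 / a - v / (a (a + v))\<close>;
  the quotient \<open>d / (a + v)\<close> is kept in the remainder because it will be bounded by 1.\<close>

lemma ratio_expansion:
  fixes a v d :: real
  assumes "a \<noteq> 0" "a + v \<noteq> 0"
  shows "d / (a + v) = d / a - d * v / a\<^sup>2 + d / (a + v) * v\<^sup>2 / a\<^sup>2"
    and "d / (a + v) = d / a - d / (a + v) * v / a"
  using assms by (simp_all add: divide_simps power2_eq_square) (simp_all add: algebra_simps)

section \<open>Error of an abstract ratio estimator\<close>

text \<open>N stands for the law of one non-empty trial and q for Q(A). The bound
  \<open>M_ge_1\<close> holds only almost surely, since a sequence of trials that all fail still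
  produces some state.\<close>

locale ratio_estimator =
  N: prob_space N for N :: "'a measure" +
  fixes H M :: "'a \<Rightarrow> real" and q B :: real and n :: nat
  assumes H_measurable: "H \<in> borel_measurable N"
    and M_measurable: "M \<in> borel_measurable N"
    and H_nonneg: "\<And>x. x \<in> space N \<Longrightarrow> 0 \<le> H x"
    and H_le_M: "\<And>x. x \<in> space N \<Longrightarrow> H x \<le> M x"
    and M_le: "\<And>x. x \<in> space N \<Longrightarrow> M x \<le> B"
    and M_ge_1: "AE x in N. 1 \<le> M x"
    and q: "0 \<le> q" "q \<le> 1"
    and expectation_H: "(\<integral>x. H x \<partial>N) = q * (\<integral>x. M x \<partial>N)"
    and n_pos: "n \<ge> 1"
begin

abbreviation "runs \<equiv> PiM {..<n} (\<lambda>_. N)"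
abbreviation "m \<equiv> \<integral>x. M x \<partial>N"
abbreviation "VarM \<equiv> \<integral>x. (M x - m)\<^sup>2 \<partial>N"
abbreviation "EM2 \<equiv> \<integral>x. M x ^ 2 \<partial>N"
abbreviation "EM4 \<equiv> \<integral>x. M x ^ 4 \<partial>N"

definition "D x = H x - q * M x"
definition "SD \<omega> = (\<Sum>i<n. D (\<omega> i))"
definition "SM \<omega> = (\<Sum>i<n. M (\<omega> i))"
definition "V \<omega> = (\<Sum>i<n. M (\<omega> i) - m)"
definition "R \<omega> = SD \<omega> / SM \<omega>"

sublocale P: prob_space runs
  by (rule prob_space_PiM) (rule N.prob_space_axioms)

lemma M_bounded: "bounded_rv N M"
  using H_nonneg H_le_M M_le M_measurable
  by (intro bounded_rvI[where C = B]) force+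

lemma H_bounded: "bounded_rv N H"
  using H_nonneg H_le_M M_le H_measurable
  by (intro bounded_rvI[where C = B]) force+

lemma D_bounded: "bounded_rv N D"
  unfolding D_def by (intro bounded_rv_intros H_bounded M_bounded)

lemma M_centered_bounded: "bounded_rv N (\<lambda>x. M x - m)"
  by (intro bounded_rv_intros M_bounded)

text \<open>Both \<open>H x\<close> and \<open>q * M x\<close> lie in the interval from 0 to
  \<open>M x\<close>.\<close>

lemma abs_D_le: "x \<in> space N \<Longrightarrow> \<bar>D x\<bar> \<le> M x"
proof -
  assume x: "x \<in> space N"
  have "0 \<le> q * M x" "q * M x \<le> M x"
    using q H_nonneg[OF x] H_le_M[OF x] mult_right_mono[of q 1 "M x"] by auto
  then show ?thesis using H_nonneg[OF x] H_le_M[OF x] unfolding D_def by linarith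
qed

lemma expectation_D: "(\<integral>x. D x \<partial>N) = 0"
  unfolding D_def
  using N.integrable_bounded_rv[OF H_bounded] N.integrable_bounded_rv[OF M_bounded]
  by (simp add: expectation_H)

lemma expectation_M_centered: "(\<integral>x. M x - m \<partial>N) = 0"
  using N.integrable_bounded_rv[OF M_bounded] by (simp add: N.prob_space)

lemma m_ge_1: "1 \<le> m"
proof -
  have "(\<integral>x. 1 \<partial>N) \<le> m"
    using N.integrable_bounded_rv[OF M_bounded] M_ge_1 by (intro integral_mono_AE) auto
  then show ?thesis by (simp add: N.prob_space)
qed

lemma expectation_D2_le: "(\<integral>x. (D x)\<^sup>2 \<partial>N) \<le> EM2"
  using abs_D_le
  by (intro integral_mono N.integrable_bounded_rv bounded_rv_power D_bounded M_bounded)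
     (auto simp: abs_le_square_iff[symmetric] intro: order_trans[OF _ abs_ge_self])

lemma VarM_eq: "VarM = EM2 - m\<^sup>2"
  using N.integrable_bounded_rv[OF M_bounded] N.integrable_bounded_rv[OF bounded_rv_power[OF M_bounded, of 2]]
  by (rule N.variance_eq)

lemma EM2_nonneg: "0 \<le> EM2" by simp

lemma VarM_nonneg: "0 \<le> VarM" by simp

text \<open>Cauchy-Schwarz against the constant 1 gives \<open>EM2 \<le> sqrt EM4\<close>; enlarging
  by 3 brings this to the form of the second summand in the mean error constant.\<close>

lemma EM2_le: "EM2 \<le> sqrt (3 * EM4)"
proof -
  have "\<bar>EM2\<bar> \<le> sqrt (EM4)"
    using N.Cauchy_Schwarz_bounded_rv[OF bounded_rv_power[OF M_bounded, of 2] bounded_rv_const[of N 1]]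
    by (simp add: N.prob_space flip: power_mult)
  moreover have "0 \<le> EM4" by simp
  then have "sqrt EM4 \<le> sqrt (3 * EM4)" by (intro real_sqrt_le_mono) linarith
  ultimately show ?thesis by linarith
qed

lemma sums_bounded: "bounded_rv runs SD" "bounded_rv runs SM" "bounded_rv runs V"
  unfolding SD_def SM_def V_def
  by (intro bounded_rv_sum bounded_rv_component D_bounded M_bounded M_centered_bounded; simp)+

lemma component_space: "\<omega> \<in> space runs \<Longrightarrow> i < n \<Longrightarrow> \<omega> i \<in> space N"
  by (auto simp: space_PiM PiE_iff)

lemma abs_SD_le: "\<omega> \<in> space runs \<Longrightarrow> \<bar>SD \<omega>\<bar> \<le> SM \<omega>"
  unfolding SD_def SM_def
  by (intro order_trans[OF sum_abs] sum_mono abs_D_le component_space) auto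

text \<open>Summing |D| \<le> M over the runs gives this at every point, also where
  \<open>SM\<close> is 0, because the quotient is then 0.\<close>

lemma abs_R_le: "\<omega> \<in> space runs \<Longrightarrow> \<bar>R \<omega>\<bar> \<le> 1"
  using abs_SD_le[of \<omega>] unfolding R_def abs_divide by (auto simp: divide_le_eq_1)

lemma R_bounded: "bounded_rv runs R"
  using bounded_rv_measurable[OF sums_bounded(1)] bounded_rv_measurable[OF sums_bounded(2)]
  by (intro bounded_rvI[where C = 1] abs_R_le) (simp_all add: R_def[abs_def])

lemma SM_eq: "SM \<omega> = real n * m + V \<omega>"
  unfolding SM_def V_def by (simp add: sum_subtractf)

lemma AE_SM_ge: "AE \<omega> in runs. real n \<le> SM \<omega>"
proof -
  have "AE \<omega> in runs. \<forall>i\<in>{..<n}. 1 \<le> M (\<omega> i)"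
    using M_ge_1 N.prob_space_axioms by (intro AE_finite_allI AE_PiM_component) auto
  then show ?thesis
  proof eventually_elim
    case (elim \<omega>)
    then have "(\<Sum>i<n. 1) \<le> SM \<omega>" unfolding SM_def by (intro sum_mono) auto
    then show ?case by simp
  qed
qed

text \<open>Only almost sure: where \<open>SM\<close> is 0 both quotients are 0 by convention, so
  the two sides read -q and 0.\<close>

lemma AE_estimator_eq: "AE \<omega> in runs. (\<Sum>i<n. H (\<omega> i)) / (\<Sum>i<n. M (\<omega> i)) - q = R \<omega>"
  using AE_SM_ge
proof eventually_elim
  case (elim \<omega>)
  then have "SM \<omega> \<noteq> 0" using n_pos by auto
  moreover have "SD \<omega> = (\<Sum>i<n. H (\<omega> i)) - q * SM \<omega>"
    unfolding SD_def SM_def D_def by (simp add: sum_subtractf sum_distrib_left)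
  ultimately show ?case unfolding R_def SM_def[symmetric] by (simp add: field_simps)
qed

lemma expectation_SD: "(\<integral>\<omega>. SD \<omega> \<partial>runs) = 0"
proof -
  have "(\<integral>\<omega>. SD \<omega> \<partial>runs) = (\<Sum>i<n. \<integral>\<omega>. D (\<omega> i) \<partial>runs)"
    unfolding SD_def
    by (intro Bochner_Integration.integral_sum P.integrable_bounded_rv bounded_rv_component D_bounded) simp
  also have "\<dots> = 0"
    by (simp add: integral_PiM_component[OF N.prob_space_axioms bounded_rv_measurable[OF D_bounded]] expectation_D)
  finally show ?thesis .
qed

lemma expectation_SD_V: "(\<integral>\<omega>. SD \<omega> * V \<omega> \<partial>runs) = real n * (\<integral>x. D x * (M x - m) \<partial>N)"
  using integral_PiM_sum_mult[OF N.prob_space_axioms D_bounded M_centered_bounded expectation_D, of "{..<n}"]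
  by (simp add: SD_def V_def)

lemma expectation_SD2: "(\<integral>\<omega>. (SD \<omega>)\<^sup>2 \<partial>runs) \<le> real n * EM2"
  using integral_PiM_sum_mult[OF N.prob_space_axioms D_bounded D_bounded expectation_D, of "{..<n}"]
    mult_left_mono[OF expectation_D2_le, of "real n"]
  by (simp add: SD_def power2_eq_square)

lemma expectation_V2: "(\<integral>\<omega>. (V \<omega>)\<^sup>2 \<partial>runs) = real n * VarM"
  using integral_PiM_sum_mult[OF N.prob_space_axioms M_centered_bounded M_centered_bounded expectation_M_centered, of "{..<n}"]
  by (simp add: V_def power2_eq_square)

text \<open>In the second-order expansion the leading term has mean 0. The cross term gives n
  E[D (M - m)], at most n sqrt(VarM EM2), and the remainder at most E[V^2] = n VarM because |R|
  \<le> 1. Over (n m)^2 these are the two parts of the constant, each with a factor 1/n.\<close>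

lemma bias_bound: "\<bar>\<integral>\<omega>. R \<omega> \<partial>runs\<bar> \<le> (VarM + sqrt (VarM * EM2)) / m\<^sup>2 / real n"
proof -
  let ?a = "real n * m"
  have a: "?a > 0" using n_pos m_ge_1 by auto
  have bd: "bounded_rv runs (\<lambda>\<omega>. SD \<omega> * V \<omega>)" "bounded_rv runs (\<lambda>\<omega>. R \<omega> * (V \<omega>)\<^sup>2)" "bounded_rv runs (\<lambda>\<omega>. (V \<omega>)\<^sup>2)"
    by (intro bounded_rv_intros sums_bounded R_bounded)+
  have "(\<integral>\<omega>. R \<omega> \<partial>runs) = (\<integral>\<omega>. SD \<omega> / ?a - SD \<omega> * V \<omega> / ?a\<^sup>2 + R \<omega> * (V \<omega>)\<^sup>2 / ?a\<^sup>2 \<partial>runs)"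
  proof (rule integral_cong_AE)
    show "R \<in> borel_measurable runs" by (rule bounded_rv_measurable[OF R_bounded])
    show "(\<lambda>\<omega>. SD \<omega> / ?a - SD \<omega> * V \<omega> / ?a\<^sup>2 + R \<omega> * (V \<omega>)\<^sup>2 / ?a\<^sup>2) \<in> borel_measurable runs"
      by (intro bounded_rv_measurable bounded_rv_intros sums_bounded R_bounded)
    show "AE \<omega> in runs. R \<omega> = SD \<omega> / ?a - SD \<omega> * V \<omega> / ?a\<^sup>2 + R \<omega> * (V \<omega>)\<^sup>2 / ?a\<^sup>2"
      using AE_SM_ge
    proof eventually_elim
      case (elim \<omega>)
      then have "?a + V \<omega> \<noteq> 0" using n_pos SM_eq[of \<omega>] by auto
      then show ?case
        unfolding R_def SM_eq using a by (intro ratio_expansion(1)) linarith+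
    qed
  qed
  also have "\<dots> = - (\<integral>\<omega>. SD \<omega> * V \<omega> \<partial>runs) / ?a\<^sup>2 + (\<integral>\<omega>. R \<omega> * (V \<omega>)\<^sup>2 \<partial>runs) / ?a\<^sup>2"
    using P.integrable_bounded_rv[OF bd(1)] P.integrable_bounded_rv[OF bd(2)]
      P.integrable_bounded_rv[OF sums_bounded(1)]
    by (simp add: expectation_SD)
  finally have "\<bar>\<integral>\<omega>. R \<omega> \<partial>runs\<bar>
      \<le> (\<bar>\<integral>\<omega>. SD \<omega> * V \<omega> \<partial>runs\<bar> + \<bar>\<integral>\<omega>. R \<omega> * (V \<omega>)\<^sup>2 \<partial>runs\<bar>) / ?a\<^sup>2"
    by (simp add: abs_divide add_divide_distrib flip: diff_divide_distrib add_divide_distrib) 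
       (simp add: divide_right_mono)
  also have "\<dots> \<le> (real n * sqrt (VarM * EM2) + real n * VarM) / ?a\<^sup>2"
  proof (intro divide_right_mono add_mono)
    have "\<bar>\<integral>x. D x * (M x - m) \<partial>N\<bar> \<le> sqrt ((\<integral>x. (D x)\<^sup>2 \<partial>N) * VarM)"
      by (rule N.Cauchy_Schwarz_bounded_rv[OF D_bounded M_centered_bounded])
    also have "\<dots> \<le> sqrt (VarM * EM2)"
      using mult_right_mono[OF expectation_D2_le VarM_nonneg] by (intro real_sqrt_le_mono) (simp add: mult.commute)
    finally show "\<bar>\<integral>\<omega>. SD \<omega> * V \<omega> \<partial>runs\<bar> \<le> real n * sqrt (VarM * EM2)"
      by (simp add: expectation_SD_V abs_mult mult_left_mono)
    have "\<bar>\<integral>\<omega>. R \<omega> * (V \<omega>)\<^sup>2 \<partial>runs\<bar> \<le> (\<integral>\<omega>. \<bar>R \<omega> * (V \<omega>)\<^sup>2\<bar> \<partial>runs)"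
      by (rule integral_abs_bound)
    also have "\<dots> \<le> (\<integral>\<omega>. (V \<omega>)\<^sup>2 \<partial>runs)"
    proof (rule integral_mono)
      show "\<bar>R \<omega> * (V \<omega>)\<^sup>2\<bar> \<le> (V \<omega>)\<^sup>2" if "\<omega> \<in> space runs" for \<omega>
        using mult_right_mono[OF abs_R_le[OF that], of "(V \<omega>)\<^sup>2"] by (simp add: abs_mult)
    qed (intro P.integrable_bounded_rv bounded_rv_abs bd)+
    finally show "\<bar>\<integral>\<omega>. R \<omega> * (V \<omega>)\<^sup>2 \<partial>runs\<bar> \<le> real n * VarM"
      by (simp add: expectation_V2)
  qed simp
  also have "\<dots> = (VarM + sqrt (VarM * EM2)) / m\<^sup>2 / real n"
  proof -
    \<comment> \<open>Of the two powers of n in the squared denominator, one cancels and one remains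
      as the rate.\<close>
    have "(r * x + r * y) / (r * z)\<^sup>2 = (y + x) / z\<^sup>2 / r" if "r > 0" for r x y z :: real
      using that by (simp add: power2_eq_square flip: distrib_left) (simp add: add.commute mult.left_commute)
    then show ?thesis using n_pos by simp
  qed
  finally show ?thesis .
qed

text \<open>The linear term has mean absolute value at most sqrt(n EM2) / (n m), which gives the
  rate 1/sqrt n. The remainder is a product of two fluctuating sums, each of size sqrt n in mean
  square, over n * (n m); it is of order 1/n and supplies the summand of the constant that decays
  with n.\<close>

lemma mean_error_bound:
  "(\<integral>\<omega>. \<bar>R \<omega>\<bar> \<partial>runs) \<le> (sqrt EM2 + sqrt (3 * EM4 / real n)) / m / sqrt (real n)"
proof -
  let ?a = "real n * m"
  have a: "?a > 0" using n_pos m_ge_1 by auto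
  have bd: "bounded_rv runs (\<lambda>\<omega>. \<bar>SD \<omega>\<bar>)" "bounded_rv runs (\<lambda>\<omega>. \<bar>V \<omega>\<bar>)"
    by (intro bounded_rv_abs sums_bounded)+
  have bd2: "bounded_rv runs (\<lambda>\<omega>. \<bar>SD \<omega>\<bar> * \<bar>V \<omega>\<bar>)" by (intro bounded_rv_mult bd)
  have "(\<integral>\<omega>. \<bar>R \<omega>\<bar> \<partial>runs) \<le> (\<integral>\<omega>. \<bar>SD \<omega>\<bar> / ?a + \<bar>SD \<omega>\<bar> * \<bar>V \<omega>\<bar> / (real n * ?a) \<partial>runs)"
  proof (rule integral_mono_AE)
    show "AE \<omega> in runs. \<bar>R \<omega>\<bar> \<le> \<bar>SD \<omega>\<bar> / ?a + \<bar>SD \<omega>\<bar> * \<bar>V \<omega>\<bar> / (real n * ?a)"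
      using AE_SM_ge
    proof eventually_elim
      case (elim \<omega>)
      then have pos: "SM \<omega> > 0" and nz: "?a + V \<omega> \<noteq> 0" using n_pos SM_eq[of \<omega>] by auto
      \<comment> \<open>The bound |R| \<le> 1 would lose a factor of order 1/sqrt n in the
        remainder; \<open>SM \<omega> \<ge> n\<close> keeps the smallness of
        \<open>SD \<omega>\<close>.\<close>
      have "\<bar>R \<omega>\<bar> \<le> \<bar>SD \<omega>\<bar> / real n"
        using elim n_pos pos unfolding R_def by (auto simp: abs_divide intro!: divide_left_mono)
      then have "\<bar>R \<omega>\<bar> * \<bar>V \<omega>\<bar> / ?a \<le> \<bar>SD \<omega>\<bar> / real n * \<bar>V \<omega>\<bar> / ?a"
        using a by (intro divide_right_mono mult_right_mono) auto
      moreover have "R \<omega> = SD \<omega> / ?a - R \<omega> * V \<omega> / ?a"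
        unfolding R_def SM_eq using a nz by (intro ratio_expansion(2)) linarith+
      then have "\<bar>R \<omega>\<bar> \<le> \<bar>SD \<omega> / ?a\<bar> + \<bar>R \<omega> * V \<omega> / ?a\<bar>"
        by (metis abs_triangle_ineq4)
      then have "\<bar>R \<omega>\<bar> \<le> \<bar>SD \<omega>\<bar> / ?a + \<bar>R \<omega>\<bar> * \<bar>V \<omega>\<bar> / ?a"
        unfolding abs_divide abs_mult using a m_ge_1 by simp
      ultimately show ?case by simp
    qed
  qed (intro P.integrable_bounded_rv bounded_rv_intros R_bounded sums_bounded)+
  also have "\<dots> = (\<integral>\<omega>. \<bar>SD \<omega>\<bar> \<partial>runs) / ?a + (\<integral>\<omega>. \<bar>SD \<omega>\<bar> * \<bar>V \<omega>\<bar> \<partial>runs) / (real n * ?a)"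
    using P.integrable_bounded_rv[OF bd(1)] P.integrable_bounded_rv[OF bd2] by simp
  also have "\<dots> \<le> sqrt (real n * EM2) / ?a + real n * sqrt (3 * EM4) / (real n * ?a)"
  proof (intro add_mono divide_right_mono)
    have "(\<integral>\<omega>. \<bar>SD \<omega>\<bar> \<partial>runs) \<le> sqrt (\<integral>\<omega>. (SD \<omega>)\<^sup>2 \<partial>runs)"
      using P.Cauchy_Schwarz_bounded_rv[OF bd(1) bounded_rv_const[of _ 1]] by (simp add: P.prob_space)
    also have "\<dots> \<le> sqrt (real n * EM2)" by (intro real_sqrt_le_mono expectation_SD2)
    finally show "(\<integral>\<omega>. \<bar>SD \<omega>\<bar> \<partial>runs) \<le> sqrt (real n * EM2)" .
    have "(\<integral>\<omega>. \<bar>SD \<omega>\<bar> * \<bar>V \<omega>\<bar> \<partial>runs) \<le> sqrt ((\<integral>\<omega>. (SD \<omega>)\<^sup>2 \<partial>runs) * (\<integral>\<omega>. (V \<omega>)\<^sup>2 \<partial>runs))"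
      using P.Cauchy_Schwarz_bounded_rv[OF bd] by simp
    \<comment> \<open>The variance is at most the second moment, so both factors have the common
      bound n * EM2 and the root disappears.\<close>
    also have "\<dots> \<le> sqrt ((real n * EM2) * (real n * EM2))"
      using VarM_eq VarM_nonneg EM2_nonneg
      by (intro real_sqrt_le_mono mult_mono expectation_SD2) (auto simp: expectation_V2 intro!: mult_left_mono)
    also have "\<dots> = real n * EM2" using EM2_nonneg by (simp add: real_sqrt_mult_self)
    also have "\<dots> \<le> real n * sqrt (3 * EM4)" using EM2_le by (intro mult_left_mono) auto
    finally show "(\<integral>\<omega>. \<bar>SD \<omega>\<bar> * \<bar>V \<omega>\<bar> \<partial>runs) \<le> real n * sqrt (3 * EM4)" .
  qed (use a n_pos m_ge_1 in auto)
  also have "\<dots> = (sqrt EM2 + sqrt (3 * EM4 / real n)) / m / sqrt (real n)"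
  proof -
    \<comment> \<open>In terms of r = sqrt n the remaining identity is rational and
      \<open>field_simps\<close> decides it.\<close>
    obtain r where r: "sqrt (real n) = r" "real n = r * r" "r > 0"
      using n_pos by (metis real_sqrt_gt_zero real_sqrt_mult_self abs_of_nat of_nat_0_less_iff less_le_trans zero_less_one)
    have "sqrt (real n * EM2) = r * sqrt EM2" "sqrt (3 * EM4 / real n) = sqrt (3 * EM4) / r"
      unfolding r(1)[symmetric] real_sqrt_mult real_sqrt_divide by simp_all
    moreover have "(r * x) / (r * r * y) + (r * r) * z / ((r * r) * ((r * r) * y)) = (x + z / r) / y / r"
      if "y > 0" for x y z :: real
      using that r(3) by (simp add: field_simps)
    ultimately show ?thesis
      using m_ge_1 r(3) unfolding r(1) r(2) by simp
  qed
  finally show ?thesis .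
qed

theorem estimator_bias:
  "\<bar>(\<integral>\<omega>. (\<Sum>i<n. H (\<omega> i)) / (\<Sum>i<n. M (\<omega> i)) \<partial>runs) - q\<bar> \<le> (VarM + sqrt (VarM * EM2)) / m\<^sup>2 / real n"
proof -
  have "(\<integral>\<omega>. (\<Sum>i<n. H (\<omega> i)) / (\<Sum>i<n. M (\<omega> i)) \<partial>runs) = (\<integral>\<omega>. R \<omega> + q \<partial>runs)"
  proof (rule integral_cong_AE)
    have [measurable]: "H \<in> borel_measurable N" "M \<in> borel_measurable N"
      by (rule H_measurable M_measurable)+
    show "(\<lambda>\<omega>. (\<Sum>i<n. H (\<omega> i)) / (\<Sum>i<n. M (\<omega> i))) \<in> borel_measurable runs" by measurable
    show "(\<lambda>\<omega>. R \<omega> + q) \<in> borel_measurable runs"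
      by (intro bounded_rv_measurable bounded_rv_add R_bounded bounded_rv_const)
    show "AE \<omega> in runs. (\<Sum>i<n. H (\<omega> i)) / (\<Sum>i<n. M (\<omega> i)) = R \<omega> + q"
      using AE_estimator_eq by eventually_elim linarith
  qed
  also have "\<dots> = (\<integral>\<omega>. R \<omega> \<partial>runs) + q"
    using P.integrable_bounded_rv[OF R_bounded] by (simp add: P.prob_space)
  finally show ?thesis using bias_bound by simp
qed

theorem estimator_mean_error:
  "(\<integral>\<omega>. \<bar>(\<Sum>i<n. H (\<omega> i)) / (\<Sum>i<n. M (\<omega> i)) - q\<bar> \<partial>runs)
    \<le> (sqrt EM2 + sqrt (3 * EM4 / real n)) / m / sqrt (real n)"
proof -
  have "(\<integral>\<omega>. \<bar>(\<Sum>i<n. H (\<omega> i)) / (\<Sum>i<n. M (\<omega> i)) - q\<bar> \<partial>runs) = (\<integral>\<omega>. \<bar>R \<omega>\<bar> \<partial>runs)"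
  proof (rule integral_cong_AE)
    have [measurable]: "H \<in> borel_measurable N" "M \<in> borel_measurable N"
      by (rule H_measurable M_measurable)+
    show "(\<lambda>\<omega>. \<bar>(\<Sum>i<n. H (\<omega> i)) / (\<Sum>i<n. M (\<omega> i)) - q\<bar>) \<in> borel_measurable runs" by measurable
    show "(\<lambda>\<omega>. \<bar>R \<omega>\<bar>) \<in> borel_measurable runs"
      by (intro bounded_rv_measurable bounded_rv_abs R_bounded)
    show "AE \<omega> in runs. \<bar>(\<Sum>i<n. H (\<omega> i)) / (\<Sum>i<n. M (\<omega> i)) - q\<bar> = \<bar>R \<omega>\<bar>"
      using AE_estimator_eq by eventually_elim simp
  qed
  then show ?thesis using mean_error_bound by simp
qed

end

section \<open>Generalized splitting\<close>

lemma gs_H_eq_gs_sum: "ennreal (real (gs_H s tau A st)) = gs_sum (s ^ (tau - 1)) (indicator A) st"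
proof -
  let ?I = "{..<s ^ (tau - 1)}"
  have "gs_sum (s ^ (tau - 1)) (indicator A) st = (\<Sum>i\<in>?I. if snd (st i) \<and> fst (st i) \<in> A then 1 else 0)"
    unfolding gs_sum_def by (intro sum.cong) (auto simp: indicator_def)
  also have "\<dots> = of_nat (gs_H s tau A st)"
    unfolding gs_H_def by (simp add: sum.If_cases Int_def)
  finally show ?thesis by (simp add: ennreal_of_nat_eq_real_of_nat)
qed

lemma UNIV_borel: "UNIV \<in> sets borel"
  by simp

text \<open>Makes every fact about H(A) available for M, with A the whole space.\<close>

lemma gs_M_eq_gs_H: "gs_M s tau = gs_H s tau UNIV"
  by (simp add: gs_M_def[abs_def] gs_H_def[abs_def])

lemma gs_H_mono: "A \<subseteq> B \<Longrightarrow> gs_H s tau A st \<le> gs_H s tau B st"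
  unfolding gs_H_def by (intro card_mono) auto

lemma gs_H_le: "gs_H s tau A st \<le> s ^ (tau - 1)"
proof -
  have "gs_H s tau A st \<le> card {..<s ^ (tau - 1)}"
    unfolding gs_H_def by (intro card_mono) auto
  then show ?thesis by simp
qed

lemma gs_H_measurable:
  assumes [measurable]: "A \<in> sets borel"
  shows "(\<lambda>st. real (gs_H s tau A st)) \<in> borel_measurable (gs_space (s ^ (tau - 1)))"
proof -
  have "(\<lambda>st. enn2real (gs_sum (s ^ (tau - 1)) (indicator A) st)) \<in> borel_measurable (gs_space (s ^ (tau - 1)))"
    by (intro borel_measurable_enn2real gs_sum_measurable) measurable
  then show ?thesis unfolding gs_H_eq_gs_sum[symmetric] by simp
qed

text \<open>Provides the hypothesis \<open>dens\<close> of \<open>nn_integral_gs_levels\<close>, the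
  constant being the probability of the level. Its positivity allows it to cancel against the
  normalization of the density.\<close>

lemma nn_integral_gs_q:
  fixes f :: "'a::euclidean_space \<Rightarrow> real"
  assumes f[measurable]: "f \<in> borel_measurable lborel" and f0: "\<And>x. 0 \<le> f x"
    and S[measurable]: "S \<in> borel_measurable borel"
    and v[measurable]: "v \<in> borel_measurable borel"
    and pos: "measure (density lborel (\<lambda>x. ennreal (f x))) {x. g \<le> ereal (S x)} > 0"
  shows "(\<integral>\<^sup>+x. v x * indicator {x. g \<le> ereal (S x)} x \<partial>density lborel (\<lambda>x. ennreal (f x)))
    = ennreal (measure (density lborel (\<lambda>x. ennreal (f x))) {x. g \<le> ereal (S x)}) * (\<integral>\<^sup>+x. v x \<partial>gs_q f S g)"
proof -
  let ?c = "measure (density lborel (\<lambda>x. ennreal (f x))) {x. g \<le> ereal (S x)}"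
  have fb[measurable]: "f \<in> borel_measurable borel" using f by simp
  have "ennreal ?c * (\<integral>\<^sup>+x. v x \<partial>gs_q f S g)
      = (\<integral>\<^sup>+x. ennreal ?c * (ennreal (f x * indicator {x. g \<le> ereal (S x)} x / ?c) * v x) \<partial>lborel)"
    unfolding gs_q_def by (subst nn_integral_density) (auto simp: nn_integral_cmult)
  also have "\<dots> = (\<integral>\<^sup>+x. ennreal (f x) * (v x * indicator {x. g \<le> ereal (S x)} x) \<partial>lborel)"
  proof (rule nn_integral_cong)
    fix x
    have "ennreal ?c * ennreal (f x * indicator {x. g \<le> ereal (S x)} x / ?c) = ennreal (f x * indicator {x. g \<le> ereal (S x)} x)"
      using pos f0 by (subst ennreal_mult[symmetric]) (auto simp: indicator_def)
    then show "ennreal ?c * (ennreal (f x * indicator {x. g \<le> ereal (S x)} x / ?c) * v x)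
        = ennreal (f x) * (v x * indicator {x. g \<le> ereal (S x)} x)"
      by (simp add: mult.assoc[symmetric] del: times_divide_eq_right) (auto simp: indicator_def)
  qed
  also have "\<dots> = (\<integral>\<^sup>+x. v x * indicator {x. g \<le> ereal (S x)} x \<partial>density lborel (\<lambda>x. ennreal (f x)))"
    by (subst nn_integral_density) auto
  finally show ?thesis by simp
qed

section \<open>A trial and its law conditioned on being non-empty\<close>

locale gs_setting =
  fixes f S :: "'a::euclidean_space \<Rightarrow> real" and kap :: "nat \<Rightarrow> 'a \<Rightarrow> 'a measure"
    and gam :: "nat \<Rightarrow> ereal" and g :: real and s tau :: nat
  assumes f_meas: "f \<in> borel_measurable lborel"
    and f_nonneg: "\<And>x. 0 \<le> f x"
    and f_int: "(\<integral>\<^sup>+ x. ennreal (f x) \<partial>lborel) = 1"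
    and S_meas: "S \<in> borel_measurable borel"
    and rare_pos: "measure (density lborel (\<lambda>x. ennreal (f x))) {x. g \<le> S x} > 0"
    and s_pos: "s > 0" and tau_ge: "tau \<ge> 1"
    and gam_mono: "\<And>l. l < tau \<Longrightarrow> gam l \<le> gam (Suc l)"
    and gam_tau: "gam tau = ereal g"
    and kap_kernel: "\<And>l. l < tau \<Longrightarrow> kap l \<in> borel \<rightarrow>\<^sub>M prob_algebra borel"
    and kap_stat: "\<And>l. l < tau \<Longrightarrow> bind (gs_q f S (gam l)) (kap l) = gs_q f S (gam l)"
begin

abbreviation "D \<equiv> density lborel (\<lambda>x. ennreal (f x))"
abbreviation "T \<equiv> gs_trial f S kap gam s tau"
abbreviation "NT \<equiv> gs_nonempty_trial f S kap gam s tau"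
abbreviation "G \<equiv> {x. g \<le> S x}"
abbreviation "nonempty st \<equiv> gs_M s tau st \<noteq> 0"

lemma D_prob: "prob_space D"
proof
  show "emeasure D (space D) = 1"
    using f_meas f_int by (simp add: emeasure_density)
qed

lemma G_measurable: "G \<in> sets borel"
  using S_meas by measurable

lemma level_le: "l \<le> tau \<Longrightarrow> gam l \<le> ereal g"
proof (induction l rule: inc_induct)
  case base
  then show ?case by (simp add: gam_tau)
next
  case (step l)
  then show ?case using gam_mono[of l] by (auto intro: order_trans)
qed

text \<open>Every level set contains the target event \<open>G\<close>, which has positive
  probability, so no normalizing constant vanishes.\<close>

lemma level_pos:
  assumes "l \<le> tau"
  shows "measure D {x. gam l \<le> ereal (S x)} > 0"
proof -
  interpret D: prob_space D by (rule D_prob)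
  have "G \<subseteq> {x. gam l \<le> ereal (S x)}"
    using level_le[OF assms] by (auto intro: order_trans)
  moreover have "{x. gam l \<le> ereal (S x)} \<in> sets D"
    using S_meas by simp
  ultimately have "measure D G \<le> measure D {x. gam l \<le> ereal (S x)}"
    by (rule D.finite_measure_mono)
  with rare_pos show ?thesis by (rule less_le_trans)
qed

lemma levels_kernel: "gs_levels s kap S gam (tau - 1) \<in> D \<rightarrow>\<^sub>M prob_algebra (gs_space (s ^ (tau - 1)))"
  using gs_levels_kernel[of "tau - 1" kap S s gam] kap_kernel tau_ge S_meas by simp

lemma T_prob: "prob_space T"
  unfolding gs_trial_def
  by (rule prob_space_bind'[OF _ levels_kernel]) (simp add: space_prob_algebra D_prob)

lemma sets_T: "sets T = sets (gs_space (s ^ (tau - 1)))"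
  unfolding gs_trial_def
  by (rule sets_bind'[OF _ levels_kernel]) (simp add: space_prob_algebra D_prob)

text \<open>The initial screening is already at gamma_1, so \<open>tau - 1\<close> steps end at
  level \<open>Suc (tau - 1) = tau\<close>, where the threshold is g; this is also the exponent of
  s.\<close>

lemma nn_integral_T_H:
  assumes A: "A \<in> sets borel"
  shows "(\<integral>\<^sup>+st. ennreal (real (gs_H s tau A st)) \<partial>T) = ennreal (real (s ^ (tau - 1)) * measure D (A \<inter> G))"
proof -
  interpret D: prob_space D by (rule D_prob)
  have tau: "Suc (tau - 1) = tau" using tau_ge by simp
  have "(\<integral>\<^sup>+st. ennreal (real (gs_H s tau A st)) \<partial>T)
      = of_nat (s ^ (tau - 1)) * (\<integral>\<^sup>+x. indicator A x * indicator {x. gam (Suc (tau - 1)) \<le> ereal (S x)} x \<partial>D)"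
    unfolding gs_H_eq_gs_sum gs_trial_def
  proof (rule nn_integral_gs_levels[where Q = "\<lambda>l. gs_q f S (gam l)"
        and c = "\<lambda>l. ennreal (measure D {x. gam l \<le> ereal (S x)})"])
    show "sets (gs_q f S (gam l)) = sets borel" for l by (simp add: gs_q_def)
    show "(\<integral>\<^sup>+x. v x * indicator {x. gam i \<le> ereal (S x)} x \<partial>D)
        = ennreal (measure D {x. gam i \<le> ereal (S x)}) * (\<integral>\<^sup>+x. v x \<partial>gs_q f S (gam i))"
      if "i \<le> tau - 1" "v \<in> borel_measurable borel" for i and v :: "'a \<Rightarrow> ennreal"
      using that level_pos[of i] by (intro nn_integral_gs_q f_meas f_nonneg S_meas) auto
    fix i assume i: "i \<le> tau - 1"
    then have "i < tau" using tau_ge by linarith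
    then show "kap i \<in> borel \<rightarrow>\<^sub>M prob_algebra borel" "gam i \<le> gam (Suc i)"
        "bind (gs_q f S (gam i)) (kap i) = gs_q f S (gam i)"
      by (rule kap_kernel gam_mono kap_stat)+
  qed (use S_meas A in auto)
  also have "(\<integral>\<^sup>+x. indicator A x * indicator {x. gam (Suc (tau - 1)) \<le> ereal (S x)} x \<partial>D) = (\<integral>\<^sup>+x. indicator (A \<inter> G) x \<partial>D)"
    unfolding tau gam_tau by (intro nn_integral_cong) (auto simp: indicator_def)
  also have "\<dots> = ennreal (measure D (A \<inter> G))"
    using A G_measurable by (simp add: D.emeasure_eq_measure)
  finally show ?thesis
    by (simp add: ennreal_mult ennreal_of_nat_eq_real_of_nat)
qed

lemma H_measurable: "A \<in> sets borel \<Longrightarrow> (\<lambda>st. real (gs_H s tau A st)) \<in> borel_measurable T"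
  using gs_H_measurable[of A s tau] measurable_cong_sets[OF sets_T refl] by blast

lemma nonempty_measurable: "Measurable.pred T nonempty"
proof -
  note [measurable] = H_measurable[of UNIV]
  have "Measurable.pred T (\<lambda>st. real (gs_H s tau UNIV st) \<noteq> 0)" by measurable
  then show ?thesis by (simp add: gs_M_eq_gs_H)
qed

lemma first_success_measurable:
  "(\<lambda>\<omega>. \<omega> (LEAST i. nonempty (\<omega> i))) \<in> PiM (UNIV :: nat set) (\<lambda>_. T) \<rightarrow>\<^sub>M gs_space (s ^ (tau - 1))"
  using measurable_first_success[OF nonempty_measurable] measurable_cong_sets[OF refl sets_T] by blast

lemma NT_prob: "prob_space NT"
  unfolding gs_nonempty_trial_def
  by (intro prob_space.prob_space_distr prob_space_PiM T_prob first_success_measurable)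

lemma sets_NT: "sets NT = sets (gs_space (s ^ (tau - 1)))"
  by (simp add: gs_nonempty_trial_def)

text \<open>The conditional law in multiplied form, which avoids division in the extended
  reals.\<close>

lemma nn_integral_NT:
  assumes h: "h \<in> borel_measurable T"
    and h0: "\<And>st. st \<in> space T \<Longrightarrow> \<not> nonempty st \<Longrightarrow> h st = 0"
    and B: "\<And>st. st \<in> space T \<Longrightarrow> h st \<le> ennreal B"
  shows "emeasure T {st \<in> space T. nonempty st} * (\<integral>\<^sup>+st. h st \<partial>NT) = (\<integral>\<^sup>+st. h st \<partial>T)"
proof -
  have "h \<in> borel_measurable (gs_space (s ^ (tau - 1)))"
    using h measurable_cong_sets[OF sets_T refl] by blast
  then show ?thesis
    using nn_integral_first_success[OF T_prob nonempty_measurable h h0 B] first_success_measurable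
    unfolding gs_nonempty_trial_def by (simp add: nn_integral_distr)
qed

text \<open>An almost surely empty trial would have mean count 0, but by unbiasedness the mean count
  is s^(tau-1) times the positive probability of \<open>G\<close>.\<close>

lemma nonempty_pos: "0 < measure T {st \<in> space T. nonempty st}"
proof -
  interpret T: prob_space T by (rule T_prob)
  have "measure T {st \<in> space T. nonempty st} \<noteq> 0"
  proof
    assume "measure T {st \<in> space T. nonempty st} = 0"
    moreover have "{st \<in> space T. nonempty st} \<in> sets T"
      using nonempty_measurable by (simp only: pred_def)
    ultimately have "{st \<in> space T. nonempty st} \<in> null_sets T"
      by (intro null_setsI) (simp_all only: T.emeasure_eq_measure ennreal_0)
    then have "AE st in T. st \<notin> {st \<in> space T. nonempty st}"
      by (rule AE_not_in)
    then have "AE st in T. ennreal (real (gs_H s tau UNIV st)) = 0"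
      using AE_space[of T] by eventually_elim (simp add: gs_M_eq_gs_H)
    then have "(\<integral>\<^sup>+st. ennreal (real (gs_H s tau UNIV st)) \<partial>T) = (\<integral>\<^sup>+st. 0 \<partial>T)"
      by (rule nn_integral_cong_AE)
    also have "\<dots> = 0" by simp
    finally have "ennreal (real (s ^ (tau - 1)) * measure D (UNIV \<inter> G)) = 0"
      unfolding nn_integral_T_H[OF UNIV_borel] .
    moreover have "0 < real (s ^ (tau - 1)) * measure D (UNIV \<inter> G)"
      using s_pos rare_pos by (intro mult_pos_pos) simp_all
    ultimately show False unfolding ennreal_eq_0_iff using leD by blast
  qed
  then show ?thesis unfolding zero_less_measure_iff .
qed

lemma integral_NT_H:
  assumes A: "A \<in> sets borel"
  shows "measure T {st \<in> space T. nonempty st} * (\<integral>st. real (gs_H s tau A st) \<partial>NT)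
    = real (s ^ (tau - 1)) * measure D (A \<inter> G)"
proof -
  interpret T: prob_space T by (rule T_prob)
  interpret NT: prob_space NT by (rule NT_prob)
  have HNT: "(\<lambda>st. real (gs_H s tau A st)) \<in> borel_measurable NT"
    using gs_H_measurable[OF A, of s tau] measurable_cong_sets[OF sets_NT refl] by blast
  have "integrable NT (\<lambda>st. real (gs_H s tau A st))"
    using gs_H_le[of s tau A] HNT
    by (intro NT.integrable_const_bound[where B = "real (s ^ (tau - 1))"] AE_I2) (auto simp del: of_nat_power)
  then have "ennreal (measure T {st \<in> space T. nonempty st} * (\<integral>st. real (gs_H s tau A st) \<partial>NT))
      = emeasure T {st \<in> space T. nonempty st} * (\<integral>\<^sup>+st. ennreal (real (gs_H s tau A st)) \<partial>NT)"
    by (simp add: nn_integral_eq_integral ennreal_mult T.emeasure_eq_measure)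
  also have "\<dots> = (\<integral>\<^sup>+st. ennreal (real (gs_H s tau A st)) \<partial>T)"
  proof (rule nn_integral_NT)
    show "(\<lambda>st. ennreal (real (gs_H s tau A st))) \<in> borel_measurable T"
      using H_measurable[OF A] by simp
    show "ennreal (real (gs_H s tau A st)) \<le> ennreal (real (s ^ (tau - 1)))" for st
      using gs_H_le[of s tau A st] by (intro ennreal_leI) (simp del: of_nat_power)
    show "ennreal (real (gs_H s tau A st)) = 0" if "\<not> nonempty st" for st
      using that gs_H_mono[of A UNIV s tau st] by (simp add: gs_M_eq_gs_H)
  qed
  also have "\<dots> = ennreal (real (s ^ (tau - 1)) * measure D (A \<inter> G))"
    by (rule nn_integral_T_H[OF A])
  finally show ?thesis
    by (simp add: ennreal_inj)
qed

text \<open>Testing \<open>nn_integral_NT\<close> with the indicator of non-emptiness itself gives p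
  * NT(E) = p, and p > 0 can be cancelled.\<close>

lemma AE_NT_nonempty: "AE st in NT. nonempty st"
proof -
  interpret T: prob_space T by (rule T_prob)
  interpret NT: prob_space NT by (rule NT_prob)
  let ?E = "{st \<in> space T. nonempty st}"
  have E: "?E \<in> sets T" using nonempty_measurable by (simp add: pred_def)
  then have ENT: "?E \<in> sets NT" by (simp add: sets_T sets_NT)
  have "emeasure T ?E * (\<integral>\<^sup>+st. indicator ?E st \<partial>NT) = (\<integral>\<^sup>+st. indicator ?E st \<partial>T)"
    using E by (intro nn_integral_NT[where B = 1]) (auto simp: indicator_def)
  then have "emeasure T ?E * emeasure NT ?E = emeasure T ?E * 1"
    using E ENT by simp
  then have "measure T ?E * measure NT ?E = measure T ?E * 1"
    by (simp add: T.emeasure_eq_measure NT.emeasure_eq_measure ennreal_mult[symmetric] ennreal_inj)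
  then have "NT.prob ?E = 1" using nonempty_pos by simp
  then have "AE st in NT. st \<in> ?E" using ENT by (simp add: NT.prob_eq_1)
  then show ?thesis by (auto elim: eventually_mono)
qed

lemma gs_Q_range: "A \<in> sets borel \<Longrightarrow> 0 \<le> gs_Q f S g A" "A \<in> sets borel \<Longrightarrow> gs_Q f S g A \<le> 1"
proof -
  interpret D: prob_space D by (rule D_prob)
  show "0 \<le> gs_Q f S g A" by (simp add: gs_Q_def)
  show "gs_Q f S g A \<le> 1"
    using rare_pos G_measurable unfolding gs_Q_def by (auto simp: divide_le_eq_1 intro!: D.finite_measure_mono)
qed

lemma NT_H_measurable:
  assumes "A \<in> sets borel"
  shows "(\<lambda>st. real (gs_H s tau A st)) \<in> borel_measurable NT"
  using gs_H_measurable[OF assms, of s tau] unfolding measurable_cong_sets[OF sets_NT refl] .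

text \<open>\<open>integral_NT_H\<close> for A and for the whole space share the unknown probability
  of a non-empty trial and the factor s^(tau-1); both cancel in the quotient.\<close>

lemma integral_NT_H_eq:
  assumes A: "A \<in> sets borel"
  shows "(\<integral>st. real (gs_H s tau A st) \<partial>NT) = gs_Q f S g A * (\<integral>st. real (gs_M s tau st) \<partial>NT)"
proof -
  have ratio: "x = d / e * y" if "p * x = c * d" "p * y = c * e" "0 < p" "0 < e" for c d e p x y :: real
  proof -
    have "p * (x * e) = p * (d * y)"
      using that(1,2) by (metis mult.assoc mult.left_commute)
    then show ?thesis using that(3,4) by (simp add: field_simps)
  qed
  have "measure T {st \<in> space T. nonempty st} * (\<integral>st. real (gs_M s tau st) \<partial>NT)
      = real (s ^ (tau - 1)) * measure D G"
    using integral_NT_H[OF UNIV_borel] unfolding gs_M_eq_gs_H Int_UNIV_left .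
  then show ?thesis
    unfolding gs_Q_def by (rule ratio[OF integral_NT_H[OF A] _ nonempty_pos rare_pos])
qed

lemma ratio_estimator_NT:
  assumes A: "A \<in> sets borel" and n: "n \<ge> 1"
  shows "ratio_estimator NT (\<lambda>st. real (gs_H s tau A st)) (\<lambda>st. real (gs_M s tau st))
    (gs_Q f S g A) (real (s ^ (tau - 1))) n"
proof (intro ratio_estimator.intro ratio_estimator_axioms.intro)
  show "real (gs_H s tau A st) \<le> real (gs_M s tau st)" for st
    unfolding gs_M_eq_gs_H of_nat_le_iff by (rule gs_H_mono) (rule subset_UNIV)
  show "real (gs_M s tau st) \<le> real (s ^ (tau - 1))" for st
    unfolding gs_M_eq_gs_H of_nat_le_iff by (rule gs_H_le)
  show "AE st in NT. 1 \<le> real (gs_M s tau st)"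
    using AE_NT_nonempty by eventually_elim linarith
  show "(\<lambda>st. real (gs_M s tau st)) \<in> borel_measurable NT"
    unfolding gs_M_eq_gs_H by (rule NT_H_measurable[OF UNIV_borel])
qed (rule NT_prob NT_H_measurable[OF A] of_nat_0_le_iff gs_Q_range[OF A] integral_NT_H_eq[OF A] n)+

end

theorem theorem1:
  fixes f :: "real^'d \<Rightarrow> real" and S :: "real^'d \<Rightarrow> real"
    and kap :: "nat \<Rightarrow> real^'d \<Rightarrow> (real^'d) measure"
    and gam :: "nat \<Rightarrow> ereal" and g :: real and s tau n :: nat
  assumes f_meas: "f \<in> borel_measurable lborel"
    and f_nonneg: "\<And>x. 0 \<le> f x"
    and f_int: "(\<integral>\<^sup>+ x. ennreal (f x) \<partial>lborel) = 1"
    and S_meas: "S \<in> borel_measurable borel"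
    and rare_pos: "measure (density lborel (\<lambda>x. ennreal (f x))) {x. g \<le> S x} > 0"
    and s_ge: "s \<ge> 2" and tau_ge: "tau \<ge> 1"
    and gam0: "gam 0 = -\<infinity>"
    and gam_mono: "\<And>l. l < tau \<Longrightarrow> gam l < gam (Suc l)"
    and gam_tau: "gam tau = ereal g"
    and kap_kernel: "\<And>l. l \<le> tau \<Longrightarrow> kap l \<in> borel \<rightarrow>\<^sub>M prob_algebra borel"
    and kap_stat: "\<And>l. l \<le> tau \<Longrightarrow> bind (gs_q f S (gam l)) (kap l) = gs_q f S (gam l)"
    and n_ge: "n \<ge> 1"
  shows
    "let NT = gs_nonempty_trial f S kap gam s tau;
         m = (\<integral>st. real (gs_M s tau st) \<partial>NT);
         VarM = (\<integral>st. (real (gs_M s tau st) - m)\<^sup>2 \<partial>NT);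
         EM2 = (\<integral>st. real (gs_M s tau st) ^ 2 \<partial>NT);
         EM4 = (\<integral>st. real (gs_M s tau st) ^ 4 \<partial>NT);
         c1 = (VarM + sqrt (VarM * EM2)) / m\<^sup>2;
         ct1 = (\<lambda>k::nat. (sqrt EM2 + sqrt (3 * EM4 / real k)) / m)
     in (\<forall>A \<in> sets (borel :: (real^'d) measure).
            \<bar>(\<integral>\<omega>. gs_Qhat s tau n A \<omega> \<partial>gs_runs f S kap gam s tau n) - gs_Q f S g A\<bar>
              \<le> c1 / real n)
      \<and> (\<forall>A \<in> sets (borel :: (real^'d) measure).
            (\<integral>\<omega>. \<bar>gs_Qhat s tau n A \<omega> - gs_Q f S g A\<bar> \<partial>gs_runs f S kap gam s tau n)
              \<le> ct1 n / sqrt (real n))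
      \<and> (\<exists>B. \<forall>k\<ge>1. ct1 k \<le> B)"
proof -
  interpret gs: gs_setting f S kap gam g s tau
  proof
    show "gam l \<le> gam (Suc l)" if "l < tau" for l
      using gam_mono[OF that] by (rule less_imp_le)
    show "kap l \<in> borel \<rightarrow>\<^sub>M prob_algebra borel" if "l < tau" for l
      by (rule kap_kernel) (rule less_imp_le[OF that])
    show "bind (gs_q f S (gam l)) (kap l) = gs_q f S (gam l)" if "l < tau" for l
      by (rule kap_stat) (rule less_imp_le[OF that])
    show "0 < s" using s_ge by linarith
  qed (rule f_meas f_nonneg f_int S_meas rare_pos tau_ge gam_tau)+
  note ratio = gs.ratio_estimator_NT[OF _ n_ge]
  let ?M = "\<lambda>k. \<integral>st. real (gs_M s tau st) ^ k \<partial>gs.NT" and ?m = "\<integral>st. real (gs_M s tau st) \<partial>gs.NT"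
  \<comment> \<open>The moments of M do not depend on A, so the instance for the whole space
    suffices.\<close>
  have "1 \<le> ?m"
    by (rule ratio_estimator.m_ge_1[OF ratio[of UNIV]]) simp
  then have "(sqrt (?M 2) + sqrt (3 * ?M 4 / real k)) / ?m \<le> (sqrt (?M 2) + sqrt (3 * ?M 4)) / ?m" if "k \<ge> 1" for k
  proof -
    \<comment> \<open>The constant decreases in k, so its value at k = 1 is a uniform bound.\<close>
    have "3 * ?M 4 / real k \<le> 3 * ?M 4 / 1"
      using that by (intro divide_left_mono) auto
    then show ?thesis using \<open>1 \<le> ?m\<close> by (intro divide_right_mono) auto
  qed
  then have "\<exists>B. \<forall>k\<ge>1. (sqrt (?M 2) + sqrt (3 * ?M 4 / real k)) / ?m \<le> B"
    by blast
  then show ?thesis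
    unfolding Let_def gs_Qhat_def gs_runs_def
    by (intro conjI ballI ratio_estimator.estimator_bias[OF ratio] ratio_estimator.estimator_mean_error[OF ratio])
qed

end
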